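(* For every $K\in\mathbb{T}^3$ there exist thresholds $\tilde\gamma_1(K)>0$ and $\tilde\gamma_2(K)>0$ such that, if $\gamma>\max\{\tilde\gamma_1(K),\tilde\gamma_2(K)\}$, then for all sufficiently large $\lambda>0$ (depending on $K$ and $\gamma$) the operator $H_{\gamma,\lambda}(K)$ has at least three eigenvalues below and at least three eigenvalues above (between it and the three-particle branch) the two-particle branch $[\tau_{\gamma,\min}(K,\lambda),\tau_{\gamma,\max}(K,\lambda)]$ of its essential spectrum, eigenvalues being counted with multiplicity.
   Context: $\mathbb{T}^3=(-\pi,\pi]^3$ is the three-dimensional torus (coordinates mod $2\pi$) and $\epsilon(p)=\sum_{i=1}^3(1-\cos p_i)$. For $\gamma>0$ and $K\in\mathbb{T}^3$ put $\mathcal{E}_{\gamma,K}(p,q)=\epsilon(p)+\epsilon(q)+\gamma\,\epsilon(K-p-q)$. Let $L^{2,a}((\mathbb{T}^3)^2)$ be the Hilbert space of $f\in L^2(\mathbb{T}^3\times\mathbb{T}^3)$ with $f(p,q)=-f(q,p)$. For $\lambda\ge0$, $H_{\gamma,\lambda}(K)$ is the bounded self-adjoint operator on $L^{2,a}((\mathbb{T}^3)^2)$ given by $$H_{\gamma,\lambda}(K)f(p,q)=\mathcal{E}_{\gamma,K}(p,q)f(p,q)-\frac{\lambda}{(2\pi)^3}\int_{\mathbb{T}^3}f(s,q)\,ds-\frac{\lambda}{(2\pi)^3}\int_{\mathbb{T}^3}f(p,s)\,ds .$$ For $q\in\mathbb{T}^3$ let $h_{\gamma,\lambda}(K,q)$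 be the self-adjoint operator on $L^2(\mathbb{T}^3)$, $h_{\gamma,\lambda}(K,q)f(p)=\mathcal{E}_{\gamma,K}(p,q)f(p)-\frac{\lambda}{(2\pi)^3}\int_{\mathbb{T}^3}f(s)\,ds$, and let $z_{\gamma,\lambda}(K,q)=\inf\sigma(h_{\gamma,\lambda}(K,q))$. Set $\tau_{\gamma,\min}(K,\lambda)=\min_q z_{\gamma,\lambda}(K,q)$ and $\tau_{\gamma,\max}(K,\lambda)=\max_q z_{\gamma,\lambda}(K,q)$. The essential spectrum of $H_{\gamma,\lambda}(K)$ is the union of the two-particle branch $[\tau_{\gamma,\min}(K,\lambda),\tau_{\gamma,\max}(K,\lambda)]$ and the three-particle branch $[\min\mathcal{E}_{\gamma,K},\max\mathcal{E}_{\gamma,K}]$; for large $\lambda$ these are disjoint. *)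

theory Defs
  imports "HOL-Analysis.Analysis" "HOL-Library.Extended_Nat"
begin

text \<open>
  Vectors of a complex \<open>L\<^sup>2\<close> space are represented by square-integrable functions, and two functions
  that agree almost everywhere are the same vector. In the following definitions, \<open>M\<close> is the
  underlying measure, \<open>V\<close> a closed linear subspace of \<open>L\<^sup>2(M)\<close>, saturated under a.e. equality, and
  \<open>A\<close> an operator on \<open>V\<close>; all equations between vectors hold almost everywhere.
\<close>

definition L2 :: "'a measure \<Rightarrow> ('a \<Rightarrow> complex) set" where
  "L2 M = {f \<in> borel_measurable M. integrable M (\<lambda>x. (cmod (f x))\<^sup>2)}"

definition L2_norm :: "'a measure \<Rightarrow> ('a \<Rightarrow> complex) \<Rightarrow> real" where
  "L2_norm M f = sqrt (\<integral>x. (cmod (f x))\<^sup>2 \<partial>M)"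

definition bounded_operator ::
    "'a measure \<Rightarrow> ('a \<Rightarrow> complex) set \<Rightarrow> (('a \<Rightarrow> complex) \<Rightarrow> 'a \<Rightarrow> complex) \<Rightarrow> bool" where
  "bounded_operator M V A \<longleftrightarrow>
     (\<forall>f\<in>V. A f \<in> V) \<and>
     (\<forall>f\<in>V. \<forall>g\<in>V. \<forall>a b. AE x in M. A (\<lambda>y. a * f y + b * g y) x = a * A f x + b * A g x) \<and>
     (\<exists>C. \<forall>f\<in>V. L2_norm M (A f) \<le> C * L2_norm M f)"

definition spectrum ::
    "'a measure \<Rightarrow> ('a \<Rightarrow> complex) set \<Rightarrow> (('a \<Rightarrow> complex) \<Rightarrow> 'a \<Rightarrow> complex) \<Rightarrow> complex set" where
  "spectrum M V A = {z. \<not> (\<exists>R. bounded_operator M V R \<and>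
     (\<forall>f\<in>V. AE x in M. R (\<lambda>y. A f y - z * f y) x = f x) \<and>
     (\<forall>f\<in>V. AE x in M. A (R f) x - z * R f x = f x))}"

definition eigenspace ::
    "'a measure \<Rightarrow> ('a \<Rightarrow> complex) set \<Rightarrow> (('a \<Rightarrow> complex) \<Rightarrow> 'a \<Rightarrow> complex) \<Rightarrow> complex
      \<Rightarrow> ('a \<Rightarrow> complex) set" where
  "eigenspace M V A z = {f \<in> V. AE x in M. A f x = z * f x}"

definition independent_AE :: "'a measure \<Rightarrow> nat \<Rightarrow> (nat \<Rightarrow> 'a \<Rightarrow> complex) \<Rightarrow> bool" where
  "independent_AE M n f \<longleftrightarrow>
     (\<forall>c :: nat \<Rightarrow> complex. (AE x in M. (\<Sum>i<n. c i * f i x) = 0) \<longrightarrow> (\<forall>i<n. c i = 0))"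

text \<open>The dimension, possibly \<open>\<infinity>\<close>, of the space \<open>W\<close> modulo a.e. equality.\<close>

definition dim_AE :: "'a measure \<Rightarrow> ('a \<Rightarrow> complex) set \<Rightarrow> enat" where
  "dim_AE M W = (SUP n \<in> {n. \<exists>f. (\<forall>i<n. f i \<in> W) \<and> independent_AE M n f}. enat n)"

text \<open>
  The number of eigenvalues in the set \<open>I\<close> of reals, counted with multiplicity: the possibly
  infinite sum of the dimensions of the eigenspaces, where non-eigenvalues contribute \<open>0\<close>.
\<close>

definition eigenvalue_count ::
    "'a measure \<Rightarrow> ('a \<Rightarrow> complex) set \<Rightarrow> (('a \<Rightarrow> complex) \<Rightarrow> 'a \<Rightarrow> complex) \<Rightarrow> real set \<Rightarrow> enat" where
  "eigenvalue_count M V A I =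
     (SUP F \<in> {F. finite F \<and> F \<subseteq> I}. \<Sum>t\<in>F. dim_AE M (eigenspace M V A (complex_of_real t)))"

text \<open>
  The torus is its fundamental domain with Lebesgue measure. The functions below depend on their
  arguments only modulo \<open>2\<pi>\<close>, so sums and differences of points need not be reduced.
\<close>

definition torus :: "(real^3) set" where
  "torus = {p. \<forall>i. - pi < p $ i \<and> p $ i \<le> pi}"

definition torus_measure :: "(real^3) measure" where
  "torus_measure = restrict_space lborel torus"

abbreviation torus2_measure :: "((real^3) \<times> (real^3)) measure" where
  "torus2_measure \<equiv> torus_measure \<Otimes>\<^sub>M torus_measure"

definition L2_anti :: "((real^3) \<times> (real^3) \<Rightarrow> complex) set" where
  "L2_anti = {f \<in> L2 torus2_measure. AE (p, q) in torus2_measure. f (p, q) = - f (q, p)}"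

definition eps :: "real^3 \<Rightarrow> real" where
  "eps p = (\<Sum>i\<in>UNIV. 1 - cos (p $ i))"

definition dispersion :: "real \<Rightarrow> real^3 \<Rightarrow> real^3 \<Rightarrow> real^3 \<Rightarrow> real" where
  "dispersion \<gamma> K p q = eps p + eps q + \<gamma> * eps (K - p - q)"

definition H_op ::
    "real \<Rightarrow> real \<Rightarrow> real^3 \<Rightarrow> ((real^3) \<times> (real^3) \<Rightarrow> complex) \<Rightarrow> (real^3) \<times> (real^3) \<Rightarrow> complex" where
  "H_op \<gamma> lam K f = (\<lambda>(p, q).
     complex_of_real (dispersion \<gamma> K p q) * f (p, q)
     - complex_of_real (lam / (2 * pi) ^ 3) * (\<integral>s. f (s, q) \<partial>torus_measure)
     - complex_of_real (lam / (2 * pi) ^ 3) * (\<integral>s. f (p, s) \<partial>torus_measure))"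

definition h_op ::
    "real \<Rightarrow> real \<Rightarrow> real^3 \<Rightarrow> real^3 \<Rightarrow> (real^3 \<Rightarrow> complex) \<Rightarrow> real^3 \<Rightarrow> complex" where
  "h_op \<gamma> lam K q f = (\<lambda>p.
     complex_of_real (dispersion \<gamma> K p q) * f p
     - complex_of_real (lam / (2 * pi) ^ 3) * (\<integral>s. f s \<partial>torus_measure))"

text \<open>
  The operator is self-adjoint, so its spectrum is real and taking real parts only changes the type.
\<close>

definition z_inf :: "real \<Rightarrow> real \<Rightarrow> real^3 \<Rightarrow> real^3 \<Rightarrow> real" where
  "z_inf \<gamma> lam K q = Inf (Re ` spectrum torus_measure (L2 torus_measure) (h_op \<gamma> lam K q))"

text \<open>
  The minima and maxima below are written as infima and suprema; they are attained, because the
  functions are continuous and \<open>2\<pi>\<close>-periodic.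
\<close>

definition tau_min :: "real \<Rightarrow> real^3 \<Rightarrow> real \<Rightarrow> real" where
  "tau_min \<gamma> K lam = (INF q\<in>torus. z_inf \<gamma> lam K q)"

definition tau_max :: "real \<Rightarrow> real^3 \<Rightarrow> real \<Rightarrow> real" where
  "tau_max \<gamma> K lam = (SUP q\<in>torus. z_inf \<gamma> lam K q)"

definition dispersion_min :: "real \<Rightarrow> real^3 \<Rightarrow> real" where
  "dispersion_min \<gamma> K = (INF (p, q)\<in>torus \<times> torus. dispersion \<gamma> K p q)"

end

theory Submission
  imports Defs
begin

text \<open>
  Write \<open>H = E - \<lambda> P\<close>, where \<open>E\<close> is multiplication by the dispersion and, on antisymmetric functions,
  \<open>P\<close> is the projection onto the functions \<open>\<phi>(p) - \<phi>(q)\<close> with \<open>\<phi>\<close> of mean zero. For large \<open>\<lambda>\<close> the low-lying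
  part of \<open>H\<close> is close to \<open>-\<lambda> + P E P\<close>. In terms of \<open>\<phi>\<close>, \<open>P E P\<close> is, up to terms bounded independently of
  \<open>\<gamma>\<close>, the operator \<open>3\<gamma> + \<gamma> \<Sum>\<^sub>i (|c\<^sub>i\<rangle>\<langle>c\<^sub>i| - |s\<^sub>i\<rangle>\<langle>s\<^sub>i|)\<close> with \<open>c\<^sub>i(p) = cos (p\<^sub>i - K\<^sub>i/2)\<close>,
  \<open>s\<^sub>i(p) = sin (p\<^sub>i - K\<^sub>i/2)\<close>. It has the triple eigenvalues \<open>3\<gamma> \<plusminus> \<gamma>/2\<close>, whereas the two-particle branch lies
  in \<open>[3\<gamma>, 3\<gamma> + 9] - \<lambda>\<close>. Each triple eigenvalue persists as a three-dimensional invariant subspace of \<open>H\<close>,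
  a graph found by a contraction argument on bounded continuous functions; \<open>H\<close> is symmetric on it and can be
  diagonalized there.
\<close>

section \<open>Symmetric operators and invariant graphs\<close>

text \<open>The triples are separated from the rest of the range of P only by a gap of \<gamma> / 2,
  while E couples this range to its complement with strength of order \<gamma>. So \<lambda> has to
  suppress the coupling, and \<gamma> has to beat the constants that remain. The upper triple lies
  above the two-particle branch, where a minimax count from below does not reach it; an invariant
  graph treats both triples alike and produces the eigenvectors themselves. The sup norm serves
  because averages, trigonometric coefficients and multiplication by E are bounded in it with
  explicit constants, and because the fixed point is then a continuous function for which all
  identities hold pointwise. The L^2 product returns only to make the resulting 3 by 3 problem
  symmetric. The shift by K/2 absorbs K, so that one absolute threshold for \<gamma> works for all
  K.\<close>

lemma selfadjoint_eigenvector: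
  fixes N :: "'a::euclidean_space \<Rightarrow> 'a" and g :: "'a \<Rightarrow> 'a \<Rightarrow> real"
  assumes N: "linear N" and g: "bilinear g"
    and sym: "\<And>x y. g x y = g y x" and pos: "\<And>x. x \<noteq> 0 \<Longrightarrow> g x x > 0"
    and adj: "\<And>x y. g (N x) y = g x (N y)"
    and S: "subspace S" "N ` S \<subseteq> S" "S \<noteq> {0}"
  obtains x z where "x \<in> S" "x \<noteq> 0" "N x = z *\<^sub>R x"
proof -
  interpret N: linear N by (rule N)
  have bb: "bounded_bilinear g" using g bilinear_conv_bounded_bilinear by blast
  interpret g: bounded_bilinear g by (rule bb)
  define C where "C = S \<inter> sphere 0 1"
  have 1: "compact C" unfolding C_def
    using closed_subspace[OF S(1)] by (simp add: closed_Int_compact)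
  obtain x0 where x0: "x0 \<in> S" "x0 \<noteq> 0" using S subspace_0 by blast
  have "(1 / norm x0) *\<^sub>R x0 \<in> C" using x0 S(1) by (simp add: C_def subspace_scale)
  then have 2: "C \<noteq> {}" by blast
  have contN: "continuous_on A N" for A
    using linear_continuous_on N linear_conv_bounded_linear by blast
  \<comment> \<open>The Rayleigh quotient is homogeneous of degree 0, so its maximum over the
    Euclidean unit sphere of \<open>S\<close> is its maximum over all nonzero vectors of
    \<open>S\<close>, although \<open>g\<close> is a different form.\<close>
  have "continuous_on C (\<lambda>x. g (N x) x / g x x)"
    by (intro continuous_intros g.continuous_on contN) (metis C_def IntD2 less_irrefl mem_sphere_0 norm_zero pos zero_neq_one)
  from continuous_attains_sup[OF 1 2 this] obtain x where x: "x \<in> C"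
    and xmax: "\<And>y. y \<in> C \<Longrightarrow> g (N y) y / g y y \<le> g (N x) x / g x x" by blast
  define r where "r = g (N x) x / g x x"
  have xS: "x \<in> S" "x \<noteq> 0" using x by (auto simp: C_def)
  \<comment> \<open>By maximality of \<open>r\<close>, \<open>q\<close> is a positive semidefinite
    form on \<open>S\<close> with \<open>q x x = 0\<close>. Such an \<open>x\<close> lies in the
    kernel of the form, which is the eigenvalue equation.\<close>
  define q where "q y w = r * g y w - g (N y) w" for y w
  have qxx: "q x x = 0" using pos[OF xS(2)] by (simp add: q_def r_def)
  have qpos: "q y y \<ge> 0" if "y \<in> S" for y
  proof (cases "y = 0")
    case True then show ?thesis by (simp add: q_def g.zero_left)
  next
    case False
    let ?y = "(1 / norm y) *\<^sub>R y"
    have "?y \<in> C" using that False S(1) by (simp add: C_def subspace_scale)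
    from xmax[OF this] have "g (N y) y / g y y \<le> r"
      using False by (simp add: N.scale g.scaleR_left g.scaleR_right r_def divide_simps)
    then show ?thesis using pos[OF False] by (simp add: q_def divide_simps split: if_splits)
  qed
  have qx: "q x y = 0" if y: "y \<in> S" for y
  proof -
    have ineq: "2 * t * q x y + t\<^sup>2 * q y y \<ge> 0" for t
    proof -
      have "x + t *\<^sub>R y \<in> S" using xS y S(1) by (simp add: subspace_add subspace_scale)
      from qpos[OF this] have "q (x + t *\<^sub>R y) (x + t *\<^sub>R y) \<ge> 0" .
      also have "q (x + t *\<^sub>R y) (x + t *\<^sub>R y) = q x x + 2 * t * q x y + t\<^sup>2 * q y y"
        using sym[of x y] adj[of y x] sym[of "N x" y]
        by (simp add: q_def N.add N.scale g.add_left g.add_right g.scaleR_left g.scaleR_right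
            power2_eq_square algebra_simps)
      finally show ?thesis using qxx by simp
    qed
    show ?thesis
    proof (rule ccontr)
      assume ne: "q x y \<noteq> 0"
      \<comment> \<open>Minimizing over \<open>t\<close> would divide by \<open>q y y\<close>, which
        may vanish; the added 1 keeps the denominator positive and still gives a
        contradiction.\<close>
      define b where "b = q y y + 1"
      have b: "b > 0" using qpos[OF y] by (simp add: b_def)
      have "2 * (- q x y / b) * q x y + (- q x y / b)\<^sup>2 * q y y \<ge> 0" by (rule ineq)
      then have "- 2 * (q x y)\<^sup>2 * b + (q x y)\<^sup>2 * q y y \<ge> 0"
        using b by (simp add: divide_simps power2_eq_square algebra_simps split: if_splits)
      then have "(q x y)\<^sup>2 * (2 + q y y) \<le> 0" by (simp add: b_def algebra_simps)
      moreover have "(q x y)\<^sup>2 * (2 + q y y) > 0"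
        using ne qpos[OF y] by (intro mult_pos_pos) auto
      ultimately show False by simp
    qed
  qed
  let ?w = "r *\<^sub>R x - N x"
  have wS: "?w \<in> S" using xS S by (auto intro!: subspace_diff subspace_scale)
  have "g ?w ?w = q x ?w" by (simp add: q_def g.diff_left g.scaleR_left)
  then have "?w = 0" using qx[OF wS] pos[of ?w] by fastforce
  then show ?thesis using that[of x r] xS by simp
qed

text \<open>Eigenvectors are split off one at a time: the \<open>g\<close>-orthogonal complement of
  those already found is invariant under \<open>N\<close>. The form \<open>g\<close> is arbitrary
  because it will be an L^2 product pulled back along a parametrization that need not be
  isometric.\<close>

lemma selfadjoint_eigenbasis:
  fixes N :: "'a::euclidean_space \<Rightarrow> 'a" and g :: "'a \<Rightarrow> 'a \<Rightarrow> real"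
  assumes N: "linear N" and g: "bilinear g"
    and sym: "\<And>x y. g x y = g y x" and pos: "\<And>x. x \<noteq> 0 \<Longrightarrow> g x x > 0"
    and adj: "\<And>x y. g (N x) y = g x (N y)"
  obtains B where "independent B" "card B = DIM('a)" "\<And>x. x \<in> B \<Longrightarrow> \<exists>z. N x = z *\<^sub>R x"
proof -
  interpret N: linear N by (rule N)
  have bb: "bounded_bilinear g" using g bilinear_conv_bounded_bilinear by blast
  interpret g: bounded_bilinear g by (rule bb)
  have "\<exists>B. independent B \<and> card B = n \<and> (\<forall>x\<in>B. \<exists>z. N x = z *\<^sub>R x)" if "n \<le> DIM('a)" for n
    using that
  proof (induction n)
    case 0
    show ?case by (rule exI[of _ "{}"]) (simp add: independent_empty)
  next
    case (Suc n)
    then obtain B where B: "independent B" "card B = n" "\<And>x. x \<in> B \<Longrightarrow> \<exists>z. N x = z *\<^sub>R x" by auto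
    define S where "S = {x. \<forall>y\<in>B. g x y = 0}"
    have finB: "finite B" using B(1) independent_imp_finite by blast
    have S: "subspace S"
      by (auto simp: S_def subspace_def g.zero_left g.add_left g.scaleR_left)
    have NS: "N ` S \<subseteq> S"
    proof (clarsimp simp: S_def)
      fix x y assume x: "\<forall>y\<in>B. g x y = 0" and y: "y \<in> B"
      obtain z where "N y = z *\<^sub>R y" using B(3)[OF y] by blast
      then show "g (N x) y = 0" using x y by (simp add: adj g.scaleR_right)
    qed
    have Sne: "S \<noteq> {0}"
    proof -
      have "dim (span B) < DIM('a)"
        using Suc.prems B(2) by (simp add: dim_span dim_eq_card_independent[OF B(1)])
      \<comment> \<open>The range of \<open>G\<close> is too small for \<open>G\<close> to be
        injective, and by independence of \<open>B\<close> its kernel is the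
        \<open>g\<close>-orthogonal complement of \<open>B\<close>.\<close>
      define G where "G x = (\<Sum>y\<in>B. g x y *\<^sub>R y)" for x
      have G: "linear G"
        by (rule linearI) (simp_all add: G_def g.add_left g.scaleR_left scaleR_add_left
            sum.distrib scaleR_sum_right)
      have "G x \<in> span B" for x
        unfolding G_def by (intro span_sum span_scale span_base)
      then have "range G \<subseteq> span B" by auto
      then have "dim (range G) < DIM('a)"
        by (metis \<open>dim (span B) < DIM('a)\<close> dim_subset le_less_trans)
      then have "\<not> surj G" by auto
      then have "\<not> inj G" using G linear_injective_imp_surjective by blast
      then obtain x where x: "x \<noteq> 0" "G x = 0"
        using linear_injective_0[OF G] by blast
      have "g x y = 0" if "y \<in> B" for y
        using independentD[OF B(1) finB subset_refl, of "g x"] x(2) that by (auto simp: G_def)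
      then show ?thesis using x by (auto simp: S_def)
    qed
    obtain x z where x: "x \<in> S" "x \<noteq> 0" "N x = z *\<^sub>R x"
      using selfadjoint_eigenvector[OF N g sym pos adj S NS Sne] by blast
    have "x \<notin> span B"
    proof
      assume "x \<in> span B"
      moreover have "subspace {y. g x y = 0}"
        by (auto simp: subspace_def g.zero_right g.add_right g.scaleR_right)
      moreover have "B \<subseteq> {y. g x y = 0}" using x by (auto simp: S_def)
      ultimately have "g x x = 0" using span_minimal by blast
      then show False using pos[OF x(2)] by simp
    qed
    then have "independent (insert x B)" "card (insert x B) = Suc n"
      using B(1,2) card_insert_disjoint[OF finB, of x] span_base[of x B] by (auto simp: independent_insert)
    then show ?case using B(3) x(3) by (intro exI[of _ "insert x B"]) auto
  qed
  from this[of "DIM('a)"] show ?thesis using that by auto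
qed

text \<open>
  The graph \<open>W = u + \<Psi>\<close> of a Riccati equation: \<open>u\<close> parametrizes an eigenspace of \<open>L0\<close> for \<open>m\<close>, \<open>l\<close> is the coordinate
  map of the spectral projection \<open>u l\<close>, and \<open>S\<close> is the reduced resolvent at \<open>m\<close>. Only the products \<open>S B\<close> and \<open>l B\<close>,
  not \<open>B\<close> itself, have to be small. The projection \<open>J\<close> singles out the subspace in which everything takes place.
\<close>

lemma invariant_graph:
  fixes L0 B S J :: "'a::banach \<Rightarrow>\<^sub>L 'a" and u :: "'b::banach \<Rightarrow>\<^sub>L 'a" and l :: "'a \<Rightarrow>\<^sub>L 'b"
  assumes lu: "\<And>c. l (u c) = c" and L0u: "\<And>c. L0 (u c) = m *\<^sub>R u c"
    and lS: "\<And>x. l (S x) = 0" and L0S: "\<And>x. L0 (S x) - m *\<^sub>R S x = J x - u (l x)"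
    and JS: "\<And>x. J (S x) = S x" and JB: "\<And>x. J (B x) = B x" and Ju: "\<And>c. J (u c) = u c"
    and SB: "norm (S o\<^sub>L B) \<le> \<beta>" and lB: "norm S * norm (l o\<^sub>L B) \<le> \<beta>"
    and \<beta>: "\<beta> * (norm u + 3) \<le> 1 / 2"
  obtains W :: "'b \<Rightarrow>\<^sub>L 'a" where "\<And>c. l (W c) = c" "\<And>c. J (W c) = W c" "norm W \<le> norm u + 1"
    "\<And>c. L0 (W c) + B (W c) = m *\<^sub>R W c + W (l (B (W c)))"
proof -
  \<comment> \<open>With W = u + \<Psi>, l \<Psi> = 0 and y = \<Psi> l B W - B W, invariance reads
    (L0 - m) \<Psi> = y - u (l y). The reduced resolvent turns this into \<Psi> = S y, whose right
    side is F \<Psi>.\<close>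
  define F where "F \<Psi> = ((S o\<^sub>L \<Psi>) o\<^sub>L ((l o\<^sub>L B) o\<^sub>L (u + \<Psi>))) - ((S o\<^sub>L B) o\<^sub>L (u + \<Psi>))" for \<Psi>
  have \<beta>0: "\<beta> \<ge> 0" using SB norm_ge_zero order_trans by blast
  have comp: "norm (f o\<^sub>L h) \<le> a * b" if "norm f \<le> a" "norm h \<le> b"
    for f :: "'y::real_normed_vector \<Rightarrow>\<^sub>L 'z::real_normed_vector" and h :: "'x::real_normed_vector \<Rightarrow>\<^sub>L 'y"
      and a b
    using norm_blinfun_compose[of f h] mult_mono[OF that] that norm_ge_zero[of f] norm_ge_zero[of h]
    by (smt (verit))
  have quad: "norm ((S o\<^sub>L X) o\<^sub>L ((l o\<^sub>L B) o\<^sub>L Y)) \<le> \<beta> * norm X * norm Y"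
    for X :: "'b \<Rightarrow>\<^sub>L 'a" and Y :: "'b \<Rightarrow>\<^sub>L 'a"
  proof -
    have "norm ((S o\<^sub>L X) o\<^sub>L ((l o\<^sub>L B) o\<^sub>L Y)) \<le> (norm S * norm X) * (norm (l o\<^sub>L B) * norm Y)"
      by (intro comp order_refl)
    also have "\<dots> = (norm S * norm (l o\<^sub>L B)) * (norm X * norm Y)" by simp
    also have "\<dots> \<le> \<beta> * (norm X * norm Y)" by (rule mult_right_mono[OF lB]) simp
    finally show ?thesis by simp
  qed
  have lin: "norm ((S o\<^sub>L B) o\<^sub>L Y) \<le> \<beta> * norm Y" for Y :: "'b \<Rightarrow>\<^sub>L 'a"
    by (intro comp order_refl SB)
  have "\<exists>!\<Psi>. \<Psi> \<in> cball 0 1 \<and> F \<Psi> = \<Psi>"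
  proof (rule Banach_fix[where c = "1/2"])
    show "complete (cball (0 :: 'b \<Rightarrow>\<^sub>L 'a) 1)" by (simp add: complete_eq_closed)
    show "F ` cball 0 1 \<subseteq> cball 0 1"
    proof clarsimp
      fix X :: "'b \<Rightarrow>\<^sub>L 'a" assume X: "norm X \<le> 1"
      have "norm (F X) \<le> \<beta> * norm X * norm (u + X) + \<beta> * norm (u + X)"
        unfolding F_def by (intro norm_triangle_le_diff add_mono quad lin)
      also have "\<dots> = \<beta> * norm (u + X) * (norm X + 1)" by (simp add: algebra_simps)
      also have "\<dots> \<le> \<beta> * (norm u + 1) * 2"
        using X \<beta>0 norm_triangle_ineq[of u X]
        by (intro mult_mono mult_left_mono mult_nonneg_nonneg) auto
      also have "\<dots> \<le> 1" using \<beta> \<beta>0 by (simp add: algebra_simps)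
      finally show "norm (F X) \<le> 1" .
    qed
    show "dist (F X) (F Y) \<le> 1/2 * dist X Y" if "X \<in> cball 0 1" "Y \<in> cball 0 1" for X Y
    proof -
      have X: "norm X \<le> 1" and Y: "norm Y \<le> 1" using that by auto
      have "F X - F Y = (((S o\<^sub>L (X - Y)) o\<^sub>L ((l o\<^sub>L B) o\<^sub>L (u + X)))
          + ((S o\<^sub>L Y) o\<^sub>L ((l o\<^sub>L B) o\<^sub>L (X - Y)))) - ((S o\<^sub>L B) o\<^sub>L (X - Y))"
        by (rule blinfun_eqI) (simp add: F_def blinfun.bilinear_simps)
      also have "norm \<dots> \<le> (\<beta> * norm (X - Y) * norm (u + X) + \<beta> * norm Y * norm (X - Y))
          + \<beta> * norm (X - Y)"
        by (intro norm_triangle_le_diff norm_triangle_mono add_mono quad lin)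
      also have "\<dots> = \<beta> * (norm (u + X) + norm Y + 1) * norm (X - Y)" by (simp add: algebra_simps)
      \<comment> \<open>The 3 collects 1 from \<open>X\<close> in \<open>u + X\<close>, 1 from
        \<open>Y\<close>, and 1 from the affine part of \<open>F\<close>.\<close>
      also have "\<dots> \<le> \<beta> * (norm u + 3) * norm (X - Y)"
        using X Y \<beta>0 norm_triangle_ineq[of u X] by (intro mult_right_mono mult_left_mono) auto
      also have "\<dots> \<le> 1/2 * norm (X - Y)" by (intro mult_right_mono \<beta>) simp
      finally show "dist (F X) (F Y) \<le> 1/2 * dist X Y" by (simp add: dist_norm)
    qed
  qed auto
  then obtain \<Psi> where \<Psi>: "norm \<Psi> \<le> 1" "F \<Psi> = \<Psi>" by auto
  define W where "W = u + \<Psi>"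
  have Psi: "\<Psi> c = S (\<Psi> (l (B (W c))) - B (W c))" for c
    by (subst \<Psi>(2)[symmetric]) (simp add: F_def W_def blinfun.bilinear_simps)
  have lPsi: "l (\<Psi> c) = 0" for c by (subst Psi) (simp add: lS)
  have JPsi: "J (\<Psi> c) = \<Psi> c" for c by (subst (1 2) Psi) (simp add: JS)
  show ?thesis
  proof
    show "l (W c) = c" for c by (simp add: W_def blinfun.bilinear_simps lu lPsi)
    show "J (W c) = W c" for c by (simp add: W_def blinfun.bilinear_simps Ju JPsi)
    show "norm W \<le> norm u + 1" unfolding W_def using \<Psi>(1) norm_triangle_ineq[of u \<Psi>] by simp
    show "L0 (W c) + B (W c) = m *\<^sub>R W c + W (l (B (W c)))" for c
    proof -
      let ?y = "\<Psi> (l (B (W c))) - B (W c)"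
      have "L0 (\<Psi> c) - m *\<^sub>R \<Psi> c = J ?y - u (l ?y)" by (subst (1 2) Psi) (rule L0S)
      also have "\<dots> = ?y + u (l (B (W c)))"
        by (simp add: blinfun.bilinear_simps JPsi JB lPsi)
      finally have "L0 (\<Psi> c) = m *\<^sub>R \<Psi> c + ?y + u (l (B (W c)))" by (simp add: algebra_simps)
      moreover have "L0 (W c) = m *\<^sub>R u c + L0 (\<Psi> c)" by (simp add: W_def blinfun.bilinear_simps L0u)
      moreover have "W c = u c + \<Psi> c" "W (l (B (W c))) = u (l (B (W c))) + \<Psi> (l (B (W c)))"
        by (simp_all add: W_def blinfun.bilinear_simps)
      ultimately show ?thesis by (simp add: scaleR_add_right)
    qed
  qed
qed

section \<open>Means of trigonometric functions over the torus\<close>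

definition torus_mean :: "(real^3 \<Rightarrow> real) \<Rightarrow> real" where
  "torus_mean g = (\<integral>p. g p \<partial>torus_measure) / (2 * pi) ^ 3"

lemma torus_sets [measurable, simp]: "torus \<in> sets borel"
proof -
  have "torus = (\<Inter>i. {p. - pi < p $ i} \<inter> {p. p $ i \<le> pi})" by (auto simp: torus_def)
  also have "\<dots> \<in> sets borel"
    by (intro sets.finite_INT sets.Int borel_open borel_closed open_halfspace_component_gt_cart
        closed_halfspace_component_le_cart) auto
  finally show ?thesis .
qed

lemma space_torus_measure [simp]: "space torus_measure = torus"
  by (simp add: torus_measure_def space_restrict_space)

lemma torus_measure_integral:
  fixes f :: "real^3 \<Rightarrow> 'a::{banach, second_countable_topology}"
  shows "(\<integral>p. f p \<partial>torus_measure) = (\<integral>p. indicator torus p *\<^sub>R f p \<partial>lborel)"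
  unfolding torus_measure_def by (subst integral_restrict_space) auto

text \<open>The volume is the constant case of the product formula, so both come from one Fubini
  computation in the \<open>Basis\<close>-indexed coordinates through which \<open>lborel\<close> is
  described.\<close>

lemma emeasure_torus: "emeasure torus_measure torus = ennreal ((2 * pi) ^ 3)"
  and torus_mean_prod:
  "\<And>g. (\<And>i. continuous_on UNIV (g i)) \<Longrightarrow>
    torus_mean (\<lambda>p. \<Prod>i\<in>UNIV. g i (p $ i))
      = (\<Prod>i\<in>UNIV. (\<integral>x. indicator {-pi..pi} x * g i x \<partial>lborel) / (2 * pi))"
proof -
  define I where "I = {-pi<..pi}"
  have Basis: "(Basis :: (real^3) set) = range (\<lambda>i. axis i 1)"
    by (auto simp: Basis_vec_def)
  have inj: "inj (\<lambda>i::3. axis i (1::real))" by (auto simp: inj_def axis_eq_axis)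
  define ix :: "real^3 \<Rightarrow> 3" where "ix = inv (\<lambda>i::3. axis i (1::real))"
  have ix: "ix (axis i 1) = i" for i unfolding ix_def by (rule inv_f_f[OF inj])
  have comp: "(\<Sum>b\<in>Basis. f b *\<^sub>R b) $ i = f (axis i 1)" for f :: "real^3 \<Rightarrow> real" and i
  proof -
    have "(\<Sum>b\<in>Basis. f b *\<^sub>R b) $ i = (\<Sum>j\<in>UNIV. (f (axis j 1) *\<^sub>R axis j 1 :: real^3) $ i)"
      unfolding Basis by (subst sum.reindex[OF inj]) simp
    also have "\<dots> = (\<Sum>j\<in>UNIV. if j = i then f (axis j 1) else 0)"
      by (intro sum.cong) (auto simp: axis_def)
    finally show ?thesis by simp
  qed
  have reB: "(\<Prod>b\<in>Basis. H b) = (\<Prod>i\<in>UNIV. H (axis i (1::real)))" for H :: "real^3 \<Rightarrow> real"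
    unfolding Basis by (subst prod.reindex[OF inj]) simp
  have key: "(\<integral>p. (\<Prod>i\<in>UNIV. indicator I (p $ i) * g i (p $ i)) \<partial>lborel)
      = (\<Prod>i\<in>UNIV. (\<integral>x. indicator I x * g i x \<partial>lborel))"
    if g: "\<And>i. continuous_on UNIV (g i)" for g :: "3 \<Rightarrow> real \<Rightarrow> real"
  proof -
    have [measurable]: "g i \<in> borel_measurable borel" for i
      using g borel_measurable_continuous_onI by blast
    have int: "integrable lborel (\<lambda>x. indicator I x * g i x)" for i
    proof -
      have "set_integrable lborel {-pi..pi} (g i)"
        by (intro borel_integrable_atLeastAtMost' continuous_on_subset[OF g]) auto
      then have "set_integrable lborel I (g i)"
        by (rule set_integrable_subset) (auto simp: I_def)
      then show ?thesis by (simp add: set_integrable_def)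
    qed
    interpret product_sigma_finite "\<lambda>_::real^3. lborel :: real measure" by unfold_locales
    have "(\<integral>p. (\<Prod>i\<in>UNIV. indicator I (p $ i) * g i (p $ i)) \<partial>lborel)
      = (\<integral>p. (\<Prod>i\<in>UNIV. indicator I (p $ i) * g i (p $ i))
          \<partial>(distr (\<Pi>\<^sub>M b\<in>(Basis::(real^3) set). lborel) borel (\<lambda>f. \<Sum>b\<in>Basis. f b *\<^sub>R b)))"
      by (subst lborel_eq) simp
    also have "\<dots> = (\<integral>f. (\<Prod>i\<in>UNIV. indicator I (f (axis i 1)) * g i (f (axis i 1)))
          \<partial>(\<Pi>\<^sub>M b\<in>(Basis::(real^3) set). lborel))"
      by (subst integral_distr) (simp_all add: comp I_def del: sum_component vector_scaleR_component)
    also have "\<dots> = (\<integral>f. (\<Prod>b\<in>Basis. indicator I (f b) * g (ix b) (f b))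
          \<partial>(\<Pi>\<^sub>M b\<in>(Basis::(real^3) set). lborel))"
      by (simp add: reB ix)
    also have "\<dots> = (\<Prod>b\<in>Basis. (\<integral>x. indicator I x * g (ix b) x \<partial>lborel))"
      by (rule product_integral_prod) (use int in auto)
    finally show ?thesis by (simp add: reB ix)
  qed
  have ind: "indicator torus p = (\<Prod>i\<in>UNIV. indicator I (p $ i) :: real)" for p
    by (auto simp: torus_def I_def indicator_def)
  have I: "(\<integral>x. indicator I x * h x \<partial>lborel) = (\<integral>x. indicator {-pi..pi} x * h x \<partial>lborel)"
    if "continuous_on UNIV h" for h :: "real \<Rightarrow> real"
  proof (rule integral_cong_AE)
    have [measurable]: "h \<in> borel_measurable borel"
      using that borel_measurable_continuous_onI by blast
    show "(\<lambda>x. indicator I x * h x) \<in> borel_measurable lborel"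
      "(\<lambda>x. indicator {-pi..pi} x * h x) \<in> borel_measurable lborel" by (simp_all add: I_def)
    show "AE x in lborel. indicator I x * h x = indicator {-pi..pi} x * h x"
      using AE_lborel_singleton[of "-pi"] by eventually_elim (auto simp: I_def indicator_def)
  qed
  have full: "(\<integral>p. (\<Prod>i\<in>UNIV. g i (p $ i)) \<partial>torus_measure)
      = (\<Prod>i\<in>UNIV. (\<integral>x. indicator {-pi..pi} x * g i x \<partial>lborel))"
    if g: "\<And>i. continuous_on UNIV (g i)" for g :: "3 \<Rightarrow> real \<Rightarrow> real"
    using key[OF g] by (simp add: torus_measure_integral ind prod.distrib I[OF g])
  show "torus_mean (\<lambda>p. \<Prod>i\<in>UNIV. g i (p $ i))
      = (\<Prod>i\<in>UNIV. (\<integral>x. indicator {-pi..pi} x * g i x \<partial>lborel) / (2 * pi))"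
    if g: "\<And>i. continuous_on UNIV (g i)" for g
    unfolding torus_mean_def full[OF g] by (simp add: prod_dividef)
  have "measure torus_measure torus = (2 * pi) ^ 3"
    using full[of "\<lambda>_ _. 1"] by (simp add: content_real mult.commute)
  \<comment> \<open>\<open>measure\<close> sends infinite mass to 0, so the positive value just
    computed excludes infinite mass.\<close>
  moreover from this have "emeasure torus_measure torus \<noteq> \<infinity>"
    by (auto simp: measure_def)
  ultimately show "emeasure torus_measure torus = ennreal ((2 * pi) ^ 3)"
    by (simp add: emeasure_eq_ennreal_measure)
qed

lemma trig_integral:
  "(\<integral>x. indicator {-pi..pi} x * (1::real) \<partial>lborel) = 2 * pi"
  "(\<integral>x. indicator {-pi..pi} x * cos (x - \<theta>) \<partial>lborel) = 0"
  "(\<integral>x. indicator {-pi..pi} x * (cos (x - \<theta>) * cos (x - \<eta>)) \<partial>lborel) = pi * cos (\<theta> - \<eta>)"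
proof -
  have FTC: "(\<integral>x. indicator {-pi..pi} x * f x \<partial>lborel) = F pi - F (-pi)"
    if "\<And>x. (F has_real_derivative f x) (at x)" "continuous_on UNIV f" for F f
    using integral_FTC_Icc_real[of "-pi" pi F f] that
    by (simp add: mult.commute continuous_on_eq_continuous_at)
  show "(\<integral>x. indicator {-pi..pi} x * (1::real) \<partial>lborel) = 2 * pi"
    by (subst FTC[where F = "\<lambda>x. x"]) (auto intro!: derivative_eq_intros)
  have s: "sin (pi - a) = sin (- pi - a)" for a
    using sin_periodic[of "- pi - a"] by (simp add: algebra_simps)
  have "(\<integral>x. indicator {-pi..pi} x * cos (x - \<theta>) \<partial>lborel) = sin (pi - \<theta>) - sin (- pi - \<theta>)"
    by (rule FTC) (auto intro!: derivative_eq_intros continuous_intros)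
  then show "(\<integral>x. indicator {-pi..pi} x * cos (x - \<theta>) \<partial>lborel) = 0" by (simp only: s)
  have prod: "cos (x - \<theta>) * cos (x - \<eta>) = (cos (2 * x - \<theta> - \<eta>) + cos (\<theta> - \<eta>)) / 2" for x
  proof -
    have "(x - \<theta>) - (x - \<eta>) = - (\<theta> - \<eta>)" "(x - \<theta>) + (x - \<eta>) = 2 * x - \<theta> - \<eta>" by simp_all
    then show ?thesis unfolding cos_times_cos by (metis add.commute cos_minus)
  qed
  have "(\<integral>x. indicator {-pi..pi} x * (cos (x - \<theta>) * cos (x - \<eta>)) \<partial>lborel)
      = (sin (2 * pi - \<theta> - \<eta>) / 2 + cos (\<theta> - \<eta>) * pi) / 2
      - (sin (2 * (-pi) - \<theta> - \<eta>) / 2 + cos (\<theta> - \<eta>) * (-pi)) / 2"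
    unfolding prod by (rule FTC) (auto intro!: derivative_eq_intros continuous_intros)
  moreover have "sin (2 * pi - \<theta> - \<eta>) = sin (2 * (-pi) - \<theta> - \<eta>)"
    using sin_periodic[of "2 * (-pi) - (\<theta> + \<eta>)"] sin_periodic[of "- (\<theta> + \<eta>)"]
    by (simp add: algebra_simps)
  ultimately show "(\<integral>x. indicator {-pi..pi} x * (cos (x - \<theta>) * cos (x - \<eta>)) \<partial>lborel) = pi * cos (\<theta> - \<eta>)"
    by (simp add: diff_divide_distrib add_divide_distrib)
qed

lemma torus_mean_1 [simp]: "torus_mean (\<lambda>_. 1) = 1"
  using torus_mean_prod[of "\<lambda>_ _. 1"] by (simp add: trig_integral[simplified])

lemma torus_mean_cos [simp]: "torus_mean (\<lambda>p. cos (p $ i - \<theta>)) = 0"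
proof -
  have "torus_mean (\<lambda>p. cos (p $ i - \<theta>))
      = torus_mean (\<lambda>p. \<Prod>k\<in>UNIV. (if k = i then (\<lambda>x. cos (x - \<theta>)) else (\<lambda>_. 1)) (p $ k))"
    by (simp add: if_distribR)
  also have "\<dots> = (\<Prod>k\<in>UNIV. (\<integral>x. indicator {-pi..pi} x *
      (if k = i then (\<lambda>x. cos (x - \<theta>)) else (\<lambda>_. 1)) x \<partial>lborel) / (2 * pi))"
    by (intro torus_mean_prod) (auto intro!: continuous_intros)
  also have "\<dots> = 0" by (rule prod_zero) (auto simp: trig_integral)
  finally show ?thesis .
qed

lemma torus_mean_cos_cos:
  "torus_mean (\<lambda>p. cos (p $ i - \<theta>) * cos (p $ j - \<eta>)) = (if i = j then cos (\<theta> - \<eta>) / 2 else 0)"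
proof -
  define h where "h k = (\<lambda>x. (if k = i then cos (x - \<theta>) else 1) * (if k = j then cos (x - \<eta>) else 1))"
    for k :: 3
  have "torus_mean (\<lambda>p. cos (p $ i - \<theta>) * cos (p $ j - \<eta>)) = torus_mean (\<lambda>p. \<Prod>k\<in>UNIV. h k (p $ k))"
    by (simp add: h_def prod.distrib)
  also have "\<dots> = (\<Prod>k\<in>UNIV. (\<integral>x. indicator {-pi..pi} x * h k x \<partial>lborel) / (2 * pi))"
  proof (rule torus_mean_prod)
    show "continuous_on UNIV (h k)" for k
      unfolding h_def by (cases "k = i"; cases "k = j") (auto intro!: continuous_intros)
  qed
  also have "\<dots> = (if i = j then cos (\<theta> - \<eta>) / 2 else 0)"
  proof (cases "i = j")
    case False
    then have "(\<integral>x. indicator {-pi..pi} x * h i x \<partial>lborel) = 0"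
      by (simp add: h_def trig_integral)
    then have "(\<integral>x. indicator {-pi..pi} x * h i x \<partial>lborel) / (2 * pi) = 0" by simp
    then show ?thesis using False by (auto intro!: prod_zero)
  next
    case True
    have "(\<integral>x. indicator {-pi..pi} x * h k x \<partial>lborel) / (2 * pi)
        = (if k = i then cos (\<theta> - \<eta>) / 2 else 1)" for k
      using True trig_integral(1) by (auto simp: h_def trig_integral(3))
    then show ?thesis using True by simp
  qed
  finally show ?thesis .
qed

section \<open>Rank-one perturbations of multiplication operators\<close>

lemma (in finite_measure) integrable_bounded:
  fixes f :: "'a \<Rightarrow> 'b::{banach, second_countable_topology}"
  assumes "f \<in> borel_measurable M" "\<And>x. x \<in> space M \<Longrightarrow> norm (f x) \<le> C"
  shows "integrable M f"
  using assms by (intro integrable_const_bound[where B = C]) (auto intro!: AE_I2)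

lemma (in finite_measure) L2_integrable:
  assumes "f \<in> L2 M" shows "integrable M f"
proof -
  have f: "f \<in> borel_measurable M" "integrable M (\<lambda>x. (cmod (f x))\<^sup>2)" using assms by (auto simp: L2_def)
  have "integrable M (\<lambda>x. 1 + (cmod (f x))\<^sup>2)" using f by simp
  moreover have "t \<le> 1 + t\<^sup>2" for t :: real
    using zero_le_power2[of "2 * t - 1"] by (simp add: power2_diff power_mult_distrib)
  ultimately show ?thesis
    using f(1) by (rule_tac Bochner_Integration.integrable_bound) auto
qed

lemma (in finite_measure) L2_bounded:
  assumes "f \<in> borel_measurable M" "\<And>x. x \<in> space M \<Longrightarrow> cmod (f x) \<le> C"
  shows "f \<in> L2 M"
proof -
  have "norm ((cmod (f x))\<^sup>2) \<le> C\<^sup>2" if "x \<in> space M" for x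
    using assms(2)[OF that] by (simp add: power_mono)
  then show ?thesis
    using assms(1) unfolding L2_def by (auto intro!: integrable_bounded)
qed

lemma L2_mult_bounded:
  assumes r: "r \<in> borel_measurable M" "\<And>x. x \<in> space M \<Longrightarrow> cmod (r x) \<le> C" and f: "f \<in> L2 M"
  shows "(\<lambda>x. r x * f x) \<in> L2 M"
proof -
  have 1: "integrable M (\<lambda>x. C\<^sup>2 * (cmod (f x))\<^sup>2)" using f by (simp add: L2_def)
  have 2: "(cmod (r x * f x))\<^sup>2 \<le> C\<^sup>2 * (cmod (f x))\<^sup>2" if "x \<in> space M" for x
    using r(2)[OF that] by (simp add: norm_mult power_mult_distrib power_mono mult_right_mono)
  have 3: "(\<lambda>x. (cmod (r x * f x))\<^sup>2) \<in> borel_measurable M" using r(1) f by (auto simp: L2_def)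
  have "integrable M (\<lambda>x. (cmod (r x * f x))\<^sup>2)"
    by (rule Bochner_Integration.integrable_bound[OF 1 3]) (rule AE_I2, use 2 in force)
  then show ?thesis using r(1) f by (auto simp: L2_def)
qed

lemma cmod_add_square: "(cmod (a + b))\<^sup>2 \<le> 2 * (cmod a)\<^sup>2 + 2 * (cmod b)\<^sup>2"
proof -
  have "(cmod (a + b))\<^sup>2 \<le> (cmod a + cmod b)\<^sup>2" by (simp add: norm_triangle_ineq power_mono)
  also have "\<dots> \<le> 2 * (cmod a)\<^sup>2 + 2 * (cmod b)\<^sup>2"
    using zero_le_power2[of "cmod a - cmod b"] by (simp add: power2_sum power2_diff)
  finally show ?thesis .
qed

lemma L2_add:
  assumes "f \<in> L2 M" "g \<in> L2 M" shows "(\<lambda>x. f x + g x) \<in> L2 M"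
proof -
  have "integrable M (\<lambda>x. 2 * (cmod (f x))\<^sup>2 + 2 * (cmod (g x))\<^sup>2)" using assms by (simp add: L2_def)
  then have "integrable M (\<lambda>x. (cmod (f x + g x))\<^sup>2)"
    by (rule Bochner_Integration.integrable_bound)
      (use assms in \<open>auto simp: L2_def cmod_add_square intro!: AE_I2\<close>)
  then show ?thesis using assms by (auto simp: L2_def)
qed

text \<open>Cauchy-Schwarz against the constant 1, read off from the nonnegative integral of the
  squared deviation of \<open>cmod (f x)\<close> from its mean, scaled by the total mass. The
  degenerate case is total mass 0.\<close>

lemma (in finite_measure) integral_cmod_L2_bound:
  assumes "f \<in> L2 M"
  shows "(\<integral>x. cmod (f x) \<partial>M)\<^sup>2 \<le> measure M (space M) * (\<integral>x. (cmod (f x))\<^sup>2 \<partial>M)"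
proof -
  have i: "integrable M (\<lambda>x. cmod (f x))" "integrable M (\<lambda>x. (cmod (f x))\<^sup>2)"
    using L2_integrable[OF assms] assms by (auto simp: L2_def)
  let ?I = "\<integral>x. cmod (f x) \<partial>M" and ?V = "measure M (space M)" and ?Q = "\<integral>x. (cmod (f x))\<^sup>2 \<partial>M"
  have "0 \<le> (\<integral>x. (?V * cmod (f x) - ?I)\<^sup>2 \<partial>M)" by simp
  also have "\<dots> = (\<integral>x. ?V\<^sup>2 * (cmod (f x))\<^sup>2 - 2 * ?V * ?I * cmod (f x) + ?I\<^sup>2 \<partial>M)"
    by (simp add: power2_diff power_mult_distrib algebra_simps)
  also have "\<dots> = ?V\<^sup>2 * ?Q - 2 * ?V * ?I * ?I + ?I\<^sup>2 * ?V"
    using i by simp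
  also have "\<dots> = ?V * (?V * ?Q - ?I\<^sup>2)" by (simp add: power2_eq_square algebra_simps)
  finally have "0 \<le> ?V * (?V * ?Q - ?I\<^sup>2)" .
  moreover have "?I = 0" if "?V = 0"
  proof -
    have "emeasure M (space M) = 0" using that by (simp add: emeasure_eq_measure)
    then have "AE x in M. cmod (f x) = 0"
      by (intro AE_I[where N = "space M"]) auto
    then show ?thesis by (rule integral_eq_zero_AE)
  qed
  moreover have "?V \<ge> 0" by simp
  ultimately show ?thesis by (cases "?V = 0") (simp_all add: zero_le_mult_iff)
qed

text \<open>The Sherman-Morrison formula: with \<open>r\<close> the resolvent of the multiplication,
  the inverse is again a rank-one correction of \<open>r\<close>, with coefficient
  \<open>\<kappa>\<close>. The excluded equation is the secular equation.\<close>

lemma (in finite_measure) rank_one_resolvent: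
  fixes e :: "'a \<Rightarrow> real" and z :: complex
  assumes e: "e \<in> borel_measurable M" and \<delta>: "\<delta> > 0" "\<And>x. x \<in> space M \<Longrightarrow> \<delta> \<le> cmod (e x - z)"
    and nz: "\<mu> * (\<integral>x. 1 / (e x - z) \<partial>M) \<noteq> (1::complex)"
  shows "z \<notin> spectrum M (L2 M) (\<lambda>f x. of_real (e x) * f x - \<mu> * (\<integral>x. f x \<partial>M))"
proof -
  define r where "r x = 1 / (e x - z)" for x
  define \<kappa> where "\<kappa> = \<mu> / (1 - \<mu> * (\<integral>x. r x \<partial>M))"
  define I where "I g = (\<integral>x. r x * g x \<partial>M)" for g
  define R where "R g = (\<lambda>x. r x * (g x + \<kappa> * I g))" for g
  have r: "r \<in> borel_measurable M" unfolding r_def using e by measurable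
  have rb: "cmod (r x) \<le> 1 / \<delta>" if "x \<in> space M" for x
    using \<delta>(2)[OF that] \<delta>(1) by (simp add: r_def norm_divide divide_simps)
  have ne: "of_real (e x) \<noteq> z" if "x \<in> space M" for x using \<delta>(2)[OF that] \<delta>(1) by auto
  have ri: "integrable M r" using r rb by (rule integrable_bounded)
  have rg: "(\<lambda>x. r x * g x) \<in> L2 M" if "g \<in> L2 M" for g
    using r rb that by (rule L2_mult_bounded)
  have rgi: "integrable M (\<lambda>x. r x * g x)" if "g \<in> L2 M" for g by (rule L2_integrable[OF rg[OF that]])
  have RL2: "R g \<in> L2 M" if "g \<in> L2 M" for g
  proof -
    have "(\<lambda>x. g x + \<kappa> * I g) \<in> L2 M" by (intro L2_add that L2_bounded) auto
    then show ?thesis unfolding R_def by (intro L2_mult_bounded[OF r rb])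
  qed
  have Ri: "(\<integral>x. R g x \<partial>M) = I g * (1 + \<kappa> * (\<integral>x. r x \<partial>M))" if "g \<in> L2 M" for g
  proof -
    have "(\<integral>x. R g x \<partial>M) = (\<integral>x. r x * g x + (\<kappa> * I g) * r x \<partial>M)"
      by (simp add: R_def algebra_simps)
    also have "\<dots> = I g + \<kappa> * I g * (\<integral>x. r x \<partial>M)"
      using rgi[OF that] ri by (simp add: I_def)
    finally show ?thesis by (simp add: algebra_simps)
  qed
  have nz': "1 - \<mu> * (\<integral>x. r x \<partial>M) \<noteq> 0" using nz by (simp add: r_def)
  then have \<kappa>: "\<mu> * (1 + \<kappa> * (\<integral>x. r x \<partial>M)) = \<kappa>"
    by (simp add: \<kappa>_def divide_simps)
  have "bounded_operator M (L2 M) R"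
    unfolding bounded_operator_def
  proof (intro conjI ballI allI)
    show "R f \<in> L2 M" if "f \<in> L2 M" for f by (rule RL2[OF that])
    show "AE x in M. R (\<lambda>y. a * f y + b * g y) x = a * R f x + b * R g x"
      if "f \<in> L2 M" "g \<in> L2 M" for f g a b
    proof -
      have "I (\<lambda>y. a * f y + b * g y) = (\<integral>x. a * (r x * f x) + b * (r x * g x) \<partial>M)"
        by (simp add: I_def algebra_simps)
      also have "\<dots> = a * I f + b * I g" using rgi[OF that(1)] rgi[OF that(2)] by (simp add: I_def)
      finally show ?thesis by (simp add: R_def algebra_simps)
    qed
    let ?V = "measure M (space M)"
    \<comment> \<open>The factor 2 is from \<open>cmod_add_square\<close>; the second summand bounds
      the constant function \<open>\<kappa> * I f\<close>, with one total mass from Cauchy-Schwarz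
      and one from integrating the constant.\<close>
    define D where "D = 2 / \<delta>\<^sup>2 * (1 + (cmod \<kappa>)\<^sup>2 * ?V\<^sup>2 / \<delta>\<^sup>2)"
    show "\<exists>C. \<forall>f\<in>L2 M. L2_norm M (R f) \<le> C * L2_norm M f"
    proof (intro exI ballI)
      fix f assume f: "f \<in> L2 M"
      let ?Q = "\<integral>x. (cmod (f x))\<^sup>2 \<partial>M"
      have fi: "integrable M (\<lambda>x. (cmod (f x))\<^sup>2)" using f by (simp add: L2_def)
      have "cmod (I f) \<le> (\<integral>x. cmod (r x * f x) \<partial>M)" unfolding I_def by (rule integral_norm_bound)
      also have "\<dots> \<le> (\<integral>x. cmod (f x) / \<delta> \<partial>M)"
      proof (intro integral_mono)
        show "cmod (r x * f x) \<le> cmod (f x) / \<delta>" if "x \<in> space M" for x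
          using mult_right_mono[OF rb[OF that], of "cmod (f x)"] by (simp add: norm_mult)
      qed (use rgi[OF f] L2_integrable[OF f] in \<open>auto simp del: norm_mult\<close>)
      finally have "(cmod (I f))\<^sup>2 \<le> ((\<integral>x. cmod (f x) \<partial>M) / \<delta>)\<^sup>2" by (simp add: power_mono)
      also have "\<dots> \<le> ?V * ?Q / \<delta>\<^sup>2"
        using integral_cmod_L2_bound[OF f] \<delta>(1) by (simp add: power_divide divide_right_mono)
      finally have If: "(cmod (I f))\<^sup>2 \<le> ?V * ?Q / \<delta>\<^sup>2" .
      have pt: "(cmod (R f x))\<^sup>2 \<le> 2 / \<delta>\<^sup>2 * ((cmod (f x))\<^sup>2 + (cmod \<kappa>)\<^sup>2 * (?V * ?Q / \<delta>\<^sup>2))"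
        if "x \<in> space M" for x
      proof -
        have "(cmod (R f x))\<^sup>2 = (cmod (r x))\<^sup>2 * (cmod (f x + \<kappa> * I f))\<^sup>2"
          by (simp add: R_def norm_mult power_mult_distrib)
        also have "\<dots> \<le> (1 / \<delta>)\<^sup>2 * (2 * (cmod (f x))\<^sup>2 + 2 * (cmod (\<kappa> * I f))\<^sup>2)"
          using rb[OF that] by (intro mult_mono power_mono cmod_add_square) auto
        also have "\<dots> \<le> (1 / \<delta>)\<^sup>2 * (2 * (cmod (f x))\<^sup>2 + 2 * ((cmod \<kappa>)\<^sup>2 * (?V * ?Q / \<delta>\<^sup>2)))"
          unfolding norm_mult power_mult_distrib
          by (intro mult_left_mono add_left_mono If) auto
        also have "(1 / \<delta>)\<^sup>2 * (2 * a + 2 * b) = 2 / \<delta>\<^sup>2 * (a + b)" for a b :: real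
          by (simp add: power_divide add_divide_distrib distrib_left)
        finally show ?thesis .
      qed
      have "(\<integral>x. (cmod (R f x))\<^sup>2 \<partial>M)
          \<le> (\<integral>x. 2 / \<delta>\<^sup>2 * ((cmod (f x))\<^sup>2 + (cmod \<kappa>)\<^sup>2 * (?V * ?Q / \<delta>\<^sup>2)) \<partial>M)"
        using RL2[OF f] fi pt by (intro integral_mono) (auto simp: L2_def)
      also have "\<dots> = D * ?Q" using fi by (simp add: D_def power2_eq_square field_simps)
      finally have "sqrt (\<integral>x. (cmod (R f x))\<^sup>2 \<partial>M) \<le> sqrt (D * ?Q)" by simp
      then show "L2_norm M (R f) \<le> sqrt D * L2_norm M f" by (simp add: L2_norm_def real_sqrt_mult)
    qed
  qed
  moreover have "AE x in M. R (\<lambda>y. of_real (e y) * f y - \<mu> * (\<integral>x. f x \<partial>M) - z * f y) x = f x"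
    if f: "f \<in> L2 M" for f
  proof (rule AE_I2)
    fix x assume x: "x \<in> space M"
    let ?F = "\<integral>x. f x \<partial>M"
    have "I (\<lambda>y. of_real (e y) * f y - \<mu> * ?F - z * f y) = (\<integral>x. f x - \<mu> * ?F * r x \<partial>M)"
      unfolding I_def using ne
      by (intro Bochner_Integration.integral_cong) (auto simp: r_def divide_simps, simp add: algebra_simps)
    also have "\<dots> = ?F * (1 - \<mu> * (\<integral>x. r x \<partial>M))"
      using L2_integrable[OF f] ri by (simp add: algebra_simps)
    finally have "\<kappa> * I (\<lambda>y. of_real (e y) * f y - \<mu> * ?F - z * f y) = \<mu> * ?F"
      using nz' by (simp add: \<kappa>_def)
    then show "R (\<lambda>y. of_real (e y) * f y - \<mu> * ?F - z * f y) x = f x"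
      using ne[OF x] by (simp add: R_def r_def divide_simps) (simp add: algebra_simps)
  qed
  moreover have "AE x in M. of_real (e x) * R f x - \<mu> * (\<integral>x. R f x \<partial>M) - z * R f x = f x"
    if f: "f \<in> L2 M" for f
  proof (rule AE_I2)
    fix x assume x: "x \<in> space M"
    have 1: "\<mu> * (\<integral>x. R f x \<partial>M) = \<kappa> * I f"
      unfolding Ri[OF f] by (subst \<kappa>[symmetric]) (simp add: algebra_simps)
    have 2: "(of_real (e x) - z) * R f x = f x + \<kappa> * I f"
      using ne[OF x] by (simp add: R_def r_def)
    show "of_real (e x) * R f x - \<mu> * (\<integral>x. R f x \<partial>M) - z * R f x = f x"
      using 2 unfolding 1 by (simp add: algebra_simps)
  qed
  ultimately show ?thesis unfolding spectrum_def by blast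
qed

text \<open>The eigenvalue equation holds everywhere, so \<open>A f - z f\<close> is literally the
  zero function; linearity with both coefficients 0 forces a putative inverse to send it to
  0.\<close>

lemma eigenvector_imp_spectrum:
  assumes "f \<in> L2 M" "\<And>x. A f x = z * f x" "\<not> (AE x in M. f x = 0)"
  shows "z \<in> spectrum M (L2 M) A"
  unfolding spectrum_def
proof clarify
  fix R assume R: "bounded_operator M (L2 M) R"
    and inv: "\<forall>f\<in>L2 M. AE x in M. R (\<lambda>y. A f y - z * f y) x = f x"
  have "AE x in M. R (\<lambda>y. 0 * f y + 0 * f y) x = 0 * R f x + 0 * R f x"
    using R assms(1) unfolding bounded_operator_def by blast
  moreover have "AE x in M. R (\<lambda>y. A f y - z * f y) x = f x" using inv assms(1) by blast
  ultimately have "AE x in M. f x = 0" by eventually_elim (simp add: assms(2))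
  then show False using assms(3) by blast
qed

section \<open>The two-particle branch\<close>

interpretation torus: finite_measure torus_measure
  by (rule finite_measureI) (simp add: emeasure_torus)

lemma borel_measurable_torus:
  assumes "continuous_on UNIV g" shows "g \<in> borel_measurable torus_measure"
  unfolding torus_measure_def
  by (rule measurable_restrict_space1) (simp add: assms borel_measurable_continuous_onI)

lemma torus_integrable:
  fixes g :: "real^3 \<Rightarrow> 'b::{banach, second_countable_topology}"
  assumes "continuous_on UNIV g" "\<And>p. norm (g p) \<le> C"
  shows "integrable torus_measure g"
  using assms by (intro torus.integrable_bounded) (auto intro: borel_measurable_torus)

lemma torus_mean_add:
  assumes "integrable torus_measure f" "integrable torus_measure g"
  shows "torus_mean (\<lambda>p. f p + g p) = torus_mean f + torus_mean g"
  using assms by (simp add: torus_mean_def add_divide_distrib)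

lemma torus_mean_diff:
  assumes "integrable torus_measure f" "integrable torus_measure g"
  shows "torus_mean (\<lambda>p. f p - g p) = torus_mean f - torus_mean g"
  using assms by (simp add: torus_mean_def diff_divide_distrib)

lemma torus_mean_cmult [simp]: "torus_mean (\<lambda>p. c * f p) = c * torus_mean f"
  by (simp add: torus_mean_def)

lemma torus_mean_multc [simp]: "torus_mean (\<lambda>p. f p * c) = torus_mean f * c"
  by (simp add: torus_mean_def)

lemma torus_mean_divide [simp]: "torus_mean (\<lambda>p. f p / c) = torus_mean f / c"
  by (simp add: torus_mean_def)

lemma torus_mean_const [simp]: "torus_mean (\<lambda>_. c) = c"
  using torus_mean_cmult[of c "\<lambda>_. 1"] by (simp del: torus_mean_cmult)

lemma torus_mean_sum:
  assumes "\<And>i. i \<in> I \<Longrightarrow> integrable torus_measure (f i)"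
  shows "torus_mean (\<lambda>p. \<Sum>i\<in>I. f i p) = (\<Sum>i\<in>I. torus_mean (f i))"
  using assms by (simp add: torus_mean_def sum_divide_distrib)

lemma torus_mean_mono:
  assumes "integrable torus_measure f" "integrable torus_measure g" "\<And>p. f p \<le> g p"
  shows "torus_mean f \<le> torus_mean g"
  using assms by (auto simp: torus_mean_def intro!: divide_right_mono integral_mono)

text \<open>Below 0 everything is decided by the secular equation \<open>lam * d x = 1\<close>,
  where \<open>d x\<close> is the mean of \<open>1 / (e - x)\<close>. To first order its solution is
  \<open>b - lam\<close>, with \<open>b\<close> the mean of \<open>e\<close>. Convexity puts it
  below this point, and the slack between \<open>a\<close> and \<open>b\<close> absorbs the
  correction of order \<open>1 / lam\<close>.\<close>

lemma rank_one_spectrum_bounds: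
  fixes e :: "real^3 \<Rightarrow> real" and a b lam M :: real
  defines "A \<equiv> spectrum torus_measure (L2 torus_measure)
    (\<lambda>f p. complex_of_real (e p) * f p - complex_of_real (lam / (2 * pi) ^ 3) * (\<integral>s. f s \<partial>torus_measure))"
  assumes e: "continuous_on UNIV e" "\<And>p. 0 \<le> e p" "\<And>p. e p \<le> M" and mean: "torus_mean e = b"
    and a: "0 \<le> a" "a + 1 \<le> b" and lam: "lam > b" "lam > a * (M - a)"
  shows "\<And>z. z \<in> A \<Longrightarrow> Re z \<ge> a - lam"
    and "\<exists>z\<in>A. Re z \<le> b - lam"
proof -
  define d where "d x = torus_mean (\<lambda>p. 1 / (e p - x))" for x
  have cont: "continuous_on UNIV (\<lambda>p. 1 / (e p - x))" if "x < 0" for x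
    by (intro continuous_intros e(1)) (smt (verit) e(2) that)
  have ib: "\<bar>1 / (e p - x)\<bar> \<le> 1 / (- x)" if "x < 0" for x p
    using e(2)[of p] that frac_le[of 1 1 "- x" "e p - x"] by simp
  have int: "integrable torus_measure (\<lambda>p. 1 / (e p - x))" if "x < 0" for x
    using cont[OF that] by (rule torus_integrable[where C = "1 / (- x)"]) (use ib[OF that] in simp)
  have eb: "\<bar>e p\<bar> \<le> M" for p using e(2,3)[of p] by simp
  have ei: "integrable torus_measure e" by (rule torus_integrable[OF e(1)]) (use eb in simp)
  have bM: "b \<le> M"
    using torus_mean_mono[OF ei, of "\<lambda>_. M"] e(3) mean by simp
  have neg: "a - lam < 0" "b - lam < 0" using a lam by auto
  have upper: "lam * d x < 1" if "x \<le> a - lam" for x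
  proof -
    define s where "s = lam - a"
    have s: "s > 0" using neg by (simp add: s_def)
    \<comment> \<open>the chord of the convex function \<open>e \<mapsto> 1 / (e + s)\<close> over \<open>[0, M]\<close>\<close>
    have pt: "1 / (e p - x) \<le> 1 / s - (1 / (s * (M + s))) * e p" for p
    proof -
      have "1 / (e p - x) \<le> 1 / (e p + s)" using e(2)[of p] s that by (simp add: frac_le s_def)
      also have "\<dots> \<le> 1 / s - (1 / (s * (M + s))) * e p"
      proof -
        have "e p * e p \<le> M * e p" using e(2,3)[of p] by (intro mult_right_mono) auto
        then show ?thesis using s e(2,3)[of p] eb[of p]
          by (simp add: divide_simps) (simp add: algebra_simps)
      qed
      finally show ?thesis .
    qed
    have "d x \<le> torus_mean (\<lambda>p. 1 / s - (1 / (s * (M + s))) * e p)"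
      unfolding d_def using pt ei int that neg by (intro torus_mean_mono) auto
    also have "\<dots> = 1 / s - (1 / (s * (M + s))) * b"
      using ei by (simp add: torus_mean_diff mean)
    finally have "lam * d x \<le> lam * (1 / s - (1 / (s * (M + s))) * b)"
      using a lam by (intro mult_left_mono) auto
    also have "\<dots> < 1"
    proof -
      have "lam * (M + s - b) < s * (M + s)"
      proof -
        have "s * (M + s) - lam * (M + s - b) = lam * (b - a) - a * (M - a)"
          by (simp add: s_def algebra_simps)
        also have "\<dots> > 0"
          using lam a mult_left_mono[of 1 "b - a" lam] by linarith
        finally show ?thesis by simp
      qed
      moreover have "lam * (1 / s - (1 / (s * (M + s))) * b) = lam * (M + s - b) / (s * (M + s))"
        using s bM a by (simp add: divide_simps)
      ultimately show ?thesis using s bM a by (simp add: divide_less_eq)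
    qed
    finally show ?thesis .
  qed
  have lower: "lam * d (b - lam) \<ge> 1"
  proof -
    \<comment> \<open>the tangent at \<open>e = b\<close>\<close>
    have pt: "1 / lam - (1 / lam\<^sup>2) * (e p - b) \<le> 1 / (e p - (b - lam))" for p
    proof -
      define y where "y = e p - b"
      have y: "lam + y > 0" "lam > 0" using e(2)[of p] lam a by (auto simp: y_def)
      have "(lam - y) * (lam + y) \<le> lam\<^sup>2"
        using zero_le_power2[of y] by (simp add: power2_eq_square algebra_simps)
      then have "(lam - y) / lam\<^sup>2 \<le> 1 / (lam + y)" using y by (simp add: divide_simps)
      moreover have "1 / lam - (1 / lam\<^sup>2) * y = (lam - y) / lam\<^sup>2"
        using y by (simp add: divide_simps power2_eq_square)
      ultimately show ?thesis by (simp add: y_def algebra_simps)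
    qed
    have "torus_mean (\<lambda>p. 1 / lam - (1 / lam\<^sup>2) * (e p - b)) \<le> d (b - lam)"
      unfolding d_def using pt ei int neg by (intro torus_mean_mono) auto
    moreover have "torus_mean (\<lambda>p. 1 / lam - (1 / lam\<^sup>2) * (e p - b)) = 1 / lam"
      using ei by (simp add: torus_mean_diff mean)
    ultimately show ?thesis using lam a by (simp add: divide_simps mult.commute)
  qed
  have V: "(2 * pi) ^ 3 > 0" by simp
  show "Re z \<ge> a - lam" if z: "z \<in> A" for z
  proof (rule ccontr)
    assume "\<not> Re z \<ge> a - lam"
    then have x: "Re z < a - lam" by simp
    \<comment> \<open>Comparison with the real point \<open>Re z\<close> excludes non-real
      \<open>z\<close> as well: in modulus the secular expression at \<open>z\<close> is at most
      \<open>lam * d (Re z)\<close>, hence below 1.\<close>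
    have re: "e p - Re z \<le> cmod (e p - z)" for p
      using complex_Re_le_cmod[of "e p - z"] by simp
    have pos: "e p - Re z > 0" for p using e(2)[of p] x neg by linarith
    have "cmod (complex_of_real (lam / (2 * pi) ^ 3) * (\<integral>p. 1 / (e p - z) \<partial>torus_measure))
        \<le> lam / (2 * pi) ^ 3 * (\<integral>p. cmod (1 / (e p - z)) \<partial>torus_measure)"
      unfolding norm_mult using lam a
      by (intro mult_mono integral_norm_bound) (auto simp: norm_divide norm_power)
    also have "\<dots> \<le> lam / (2 * pi) ^ 3 * (\<integral>p. 1 / (e p - Re z) \<partial>torus_measure)"
    proof (intro mult_left_mono integral_mono)
      show "cmod (1 / (e p - z)) \<le> 1 / (e p - Re z)" for p
        using re[of p] pos[of p] by (simp add: norm_divide frac_le)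
      show 1: "integrable torus_measure (\<lambda>p. 1 / (e p - Re z))" using int x neg by auto
      have 2: "(\<lambda>p. cmod (1 / (e p - z))) \<in> borel_measurable torus_measure"
        using borel_measurable_torus[OF e(1)] by measurable
      show "integrable torus_measure (\<lambda>p. cmod (1 / (e p - z)))"
      proof (rule Bochner_Integration.integrable_bound[OF 1 2], rule AE_I2)
        show "norm (cmod (1 / (e p - z))) \<le> norm (1 / (e p - Re z))" for p
          using re[of p] pos[of p] by (simp add: norm_divide frac_le)
      qed
    qed (use lam a in auto)
    also have "\<dots> = lam * d (Re z)" by (simp add: d_def torus_mean_def)
    also have "\<dots> < 1" using upper x by simp
    finally have "complex_of_real (lam / (2 * pi) ^ 3) * (\<integral>p. 1 / (e p - z) \<partial>torus_measure) \<noteq> 1"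
      by auto
    moreover have "- (a - lam) \<le> cmod (e p - z)" for p using re[of p] e(2)[of p] x by linarith
    ultimately have "z \<notin> A"
      unfolding A_def using neg borel_measurable_torus[OF e(1)]
      by (intro torus.rank_one_resolvent[where \<delta> = "- (a - lam)"]) auto
    then show False using z by simp
  qed
  have "continuous_on {a - lam..b - lam} (\<lambda>x. lam * d x)"
  proof -
    \<comment> \<open>For \<open>x \<le> b - lam\<close> every denominator \<open>e p - x\<close> is
      at least \<open>c\<close>, which makes \<open>d\<close> Lipschitz and allows the intermediate
      value theorem.\<close>
    define c where "c = lam - b"
    have c: "c > 0" using lam by (simp add: c_def)
    have "\<bar>d x - d y\<bar> \<le> 1 / c\<^sup>2 * \<bar>x - y\<bar>" if "x \<le> b - lam" "y \<le> b - lam" for x y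
    proof -
      have xy: "x < 0" "y < 0" using that neg by auto
      have pt: "\<bar>1 / (e p - x) - 1 / (e p - y)\<bar> \<le> 1 / c\<^sup>2 * \<bar>x - y\<bar>" for p
      proof -
        have g: "e p - x \<ge> c" "e p - y \<ge> c" using e(2)[of p] that by (auto simp: c_def)
        then have "\<bar>1 / (e p - x) - 1 / (e p - y)\<bar> = \<bar>x - y\<bar> / ((e p - x) * (e p - y))"
          using c by (simp add: diff_frac_eq abs_mult)
        also have "\<dots> \<le> \<bar>x - y\<bar> / (c * c)" using g c by (intro divide_left_mono mult_mono) auto
        finally show ?thesis by (simp add: power2_eq_square)
      qed
      define k where "k = 1 / c\<^sup>2 * \<bar>x - y\<bar>"
      have pt1: "1 / (e p - x) - 1 / (e p - y) \<le> k" and pt2: "- k \<le> 1 / (e p - x) - 1 / (e p - y)" for p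
        using pt[of p] unfolding k_def abs_le_iff by linarith+
      have di: "integrable torus_measure (\<lambda>p. 1 / (e p - x) - 1 / (e p - y))"
        using int xy by (intro Bochner_Integration.integrable_diff)
      have "d x - d y = torus_mean (\<lambda>p. 1 / (e p - x) - 1 / (e p - y))"
        unfolding d_def by (rule torus_mean_diff[symmetric]) (use int xy in blast)+
      moreover have "\<dots> \<le> torus_mean (\<lambda>_. k)"
        by (rule torus_mean_mono[OF di _ pt1]) simp
      moreover have "torus_mean (\<lambda>_. - k) \<le> torus_mean (\<lambda>p. 1 / (e p - x) - 1 / (e p - y))"
        by (rule torus_mean_mono[OF _ di pt2]) simp
      ultimately show ?thesis unfolding torus_mean_const k_def[symmetric] by linarith
    qed
    then have "(1 / c\<^sup>2)-lipschitz_on {a - lam..b - lam} d"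
      by (intro lipschitz_onI) (auto simp: dist_real_def)
    then show ?thesis by (intro continuous_intros lipschitz_on_continuous_on)
  qed
  then obtain x where x: "a - lam \<le> x" "x \<le> b - lam" "lam * d x = 1"
    using IVT'[of "\<lambda>x. lam * d x" "a - lam" 1 "b - lam"] upper[of "a - lam"] lower a by auto
  have x0: "x < 0" using x neg by simp
  define f where "f p = complex_of_real (1 / (e p - x))" for p
  have "complex_of_real x \<in> A"
    unfolding A_def
  proof (rule eigenvector_imp_spectrum)
    have pos: "e p - x > 0" for p using e(2)[of p] x0 by linarith
    show "f \<in> L2 torus_measure"
    proof (rule torus.L2_bounded)
      show "f \<in> borel_measurable torus_measure"
        unfolding f_def by (intro borel_measurable_torus continuous_on_of_real cont[OF x0])
      show "cmod (f p) \<le> 1 / (- x)" for p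
        unfolding f_def norm_of_real by (rule ib[OF x0])
    qed
    have "(\<integral>p. f p \<partial>torus_measure) = complex_of_real (\<integral>p. 1 / (e p - x) \<partial>torus_measure)"
      unfolding f_def by (rule integral_complex_of_real)
    then have I: "complex_of_real (lam / (2 * pi) ^ 3) * (\<integral>p. f p \<partial>torus_measure) = complex_of_real (lam * d x)"
      by (simp add: d_def torus_mean_def)
    show "complex_of_real (e p) * f p
        - complex_of_real (lam / (2 * pi) ^ 3) * (\<integral>p. f p \<partial>torus_measure) = complex_of_real x * f p" for p
    proof -
      have "e p * (1 / (e p - x)) - 1 = x * (1 / (e p - x))"
        using pos[of p] by (simp add: divide_simps)
      then have "complex_of_real (e p * (1 / (e p - x)) - 1) = complex_of_real (x * (1 / (e p - x)))"
        by (simp only:)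
      then show ?thesis unfolding I x(3) unfolding f_def
        by (simp only: of_real_mult of_real_diff of_real_1)
    qed
    show "\<not> (AE p in torus_measure. f p = 0)"
    proof
      assume "AE p in torus_measure. f p = 0"
      then have "AE p in torus_measure. False" by eventually_elim (use pos in \<open>auto simp: f_def\<close>)
      then have "emeasure torus_measure torus = 0"
        by (simp add: trivial_limit_def[symmetric] ae_filter_eq_bot_iff)
      then show False by (simp add: emeasure_torus)
    qed
  qed
  then show "\<exists>z\<in>A. Re z \<le> b - lam" using x(2) by (intro bexI) auto
qed

lemma eps_bounds: "0 \<le> eps p" "eps p \<le> 6"
proof -
  show "0 \<le> eps p" unfolding eps_def by (intro sum_nonneg) simp
  have "eps p \<le> (\<Sum>i\<in>(UNIV::3 set). 2)" unfolding eps_def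
    by (intro sum_mono) (metis cos_ge_minus_one diff_mono order_refl diff_minus_eq_add one_add_one)
  then show "eps p \<le> 6" by simp
qed

lemma continuous_on_eps [continuous_intros]:
  fixes f :: "'a::t2_space \<Rightarrow> real^3"
  shows "continuous_on S f \<Longrightarrow> continuous_on S (\<lambda>x. eps (f x))"
  unfolding eps_def by (intro continuous_intros)

lemma torus_mean_eps: "torus_mean (\<lambda>p. eps (k - p)) = 3"
proof -
  have "eps (k - p) = (\<Sum>i\<in>UNIV. 1 - cos (p $ i - k $ i))" for p
    using cos_minus[of "p $ i - k $ i" for i] by (simp add: eps_def)
  moreover have i: "integrable torus_measure (\<lambda>p. cos (p $ i - k $ i))" for i
    by (rule torus_integrable[where C = 1]) (auto intro!: continuous_intros)
  ultimately show ?thesis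
    by (simp add: torus_mean_sum torus_mean_diff)
qed

lemma dispersion_bounds:
  assumes "\<gamma> \<ge> 0"
  shows "0 \<le> dispersion \<gamma> K p q" "dispersion \<gamma> K p q \<le> 12 + 6 * \<gamma>"
proof -
  have "\<gamma> * eps (K - p - q) \<le> \<gamma> * 6" "0 \<le> \<gamma> * eps (K - p - q)"
    using assms eps_bounds by (auto intro: mult_left_mono)
  then show "0 \<le> dispersion \<gamma> K p q" "dispersion \<gamma> K p q \<le> 12 + 6 * \<gamma>"
    using eps_bounds[of p] eps_bounds[of q] by (auto simp: dispersion_def)
qed

text \<open>Averaging over \<open>p\<close> removes the shift by \<open>K - q\<close>, so the
  coefficient of \<open>\<gamma>\<close> is the constant 3. Hence the two-particle branch stays of
  bounded width while the triples move away from it by \<gamma> / 2.\<close>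

lemma torus_mean_dispersion: "torus_mean (\<lambda>p. dispersion \<gamma> K p q) = 3 + eps q + 3 * \<gamma>"
proof -
  have 1: "integrable torus_measure (\<lambda>p. eps (k - p))" for k
    by (rule torus_integrable[where C = 6]) (auto intro!: continuous_intros simp: eps_bounds)
  have 2: "eps (0 - p) = eps p" for p by (simp add: eps_def)
  have "dispersion \<gamma> K p q = eps (0 - p) + (eps q + \<gamma> * eps ((K - q) - p))" for p
    unfolding dispersion_def 2 by (simp add: algebra_simps)
  then show ?thesis using 1
    by (simp add: torus_mean_add torus_mean_eps del: diff_0)
qed

lemma torus_nonempty: "torus \<noteq> {}"
  using emeasure_torus by force

text \<open>The mean of the dispersion lies between 3 + 3\<gamma> and 9 + 3\<gamma>. Taking
  \<open>a = 3 * \<gamma>\<close> leaves more than the unit slack required, and with the maximum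
  \<open>12 + 6 * \<gamma>\<close> the product \<open>a * (M - a)\<close> is the second bound on
  \<open>lam\<close>.\<close>

lemma tau_bounds:
  assumes \<gamma>: "\<gamma> \<ge> 0" and lam: "lam > 9 + 3 * \<gamma>" "lam > 3 * \<gamma> * (12 + 3 * \<gamma>)"
  shows "3 * \<gamma> - lam \<le> tau_min \<gamma> K lam" "tau_max \<gamma> K lam \<le> 9 + 3 * \<gamma> - lam"
proof -
  let ?A = "\<lambda>q. spectrum torus_measure (L2 torus_measure) (h_op \<gamma> lam K q)"
  have A: "(\<forall>z\<in>?A q. Re z \<ge> 3 * \<gamma> - lam) \<and> (\<exists>z\<in>?A q. Re z \<le> 9 + 3 * \<gamma> - lam)" for q
  proof -
    have c: "continuous_on UNIV (\<lambda>p. dispersion \<gamma> K p q)"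
      unfolding dispersion_def by (intro continuous_intros)
    note * = rank_one_spectrum_bounds[OF c dispersion_bounds[OF \<gamma>] torus_mean_dispersion, of "3 * \<gamma>" lam]
    have "3 * \<gamma> * (12 + 6 * \<gamma> - 3 * \<gamma>) < lam" using lam(2) by (simp add: algebra_simps)
    then show ?thesis
      using *(1,2) \<gamma> lam eps_bounds[of q] unfolding h_op_def
      by (smt (verit, best))
  qed
  have z: "3 * \<gamma> - lam \<le> z_inf \<gamma> lam K q \<and> z_inf \<gamma> lam K q \<le> 9 + 3 * \<gamma> - lam" for q
  proof -
    obtain z where "z \<in> ?A q" "Re z \<le> 9 + 3 * \<gamma> - lam" using A by blast
    moreover have "bdd_below (Re ` ?A q)" using A[of q] by (auto intro!: bdd_belowI)
    ultimately show ?thesis unfolding z_inf_def using A[of q]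
      by (auto intro!: cInf_greatest intro: cInf_lower2)
  qed
  show "3 * \<gamma> - lam \<le> tau_min \<gamma> K lam" unfolding tau_min_def
    using z torus_nonempty by (intro cINF_greatest) auto
  show "tau_max \<gamma> K lam \<le> 9 + 3 * \<gamma> - lam" unfolding tau_max_def
    using z torus_nonempty by (intro cSUP_least) auto
qed

lemma dispersion_min_nonneg: "\<gamma> \<ge> 0 \<Longrightarrow> 0 \<le> dispersion_min \<gamma> K"
  unfolding dispersion_min_def using torus_nonempty
  by (intro cINF_greatest) (auto simp: dispersion_bounds)

section \<open>Operators on bounded continuous functions\<close>

instance bcontfun :: (metric_space, banach) banach ..

type_synonym real3 = "real^3"
type_synonym one_body = "real3 \<Rightarrow>\<^sub>C real"
type_synonym two_body = "(real3 \<times> real3) \<Rightarrow>\<^sub>C real"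

lemma continuous_on_bcontfun [continuous_intros]:
  "continuous_on S f \<Longrightarrow> continuous_on S (\<lambda>x. apply_bcontfun g (f x))"
  by (rule continuous_on_compose2[of UNIV "apply_bcontfun g"]) auto

text \<open>\<open>Blinfun\<close> and \<open>Bcontfun\<close> are unspecified outside their
  domains, so this has its intended meaning only under the hypotheses of
  \<open>bcont_op_apply\<close>.\<close>

definition bcont_op :: "('a::real_normed_vector \<Rightarrow> 'b::topological_space \<Rightarrow> real) \<Rightarrow> 'a \<Rightarrow>\<^sub>L ('b \<Rightarrow>\<^sub>C real)" where
  "bcont_op T = Blinfun (\<lambda>x. Bcontfun (T x))"

lemma
  assumes c: "\<And>x. continuous_on UNIV (T x)"
    and add: "\<And>x y s. T (x + y) s = T x s + T y s" and scale: "\<And>r x s. T (r *\<^sub>R x) s = r * T x s"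
    and C: "\<And>x s. \<bar>T x s\<bar> \<le> C * norm x"
  shows bcont_op_apply: "apply_bcontfun (bcont_op T x) = T x"
    and norm_bcont_op: "0 \<le> C \<Longrightarrow> norm (bcont_op T) \<le> C"
proof -
  have b: "T x \<in> bcontfun" for x
    by (rule bcontfun_normI[OF c, of _ "C * norm x"]) (use C in simp)
  have B: "apply_bcontfun (Bcontfun (T x)) = T x" for x by (rule Bcontfun_inverse[OF b])
  have bl: "bounded_linear (\<lambda>x. Bcontfun (T x))"
  proof (rule bounded_linear_intro[where K = C])
    show "norm (Bcontfun (T x)) \<le> norm x * C" for x
      by (rule norm_bound) (use C in \<open>simp add: B mult.commute\<close>)
  qed (auto intro!: bcontfun_eqI simp: B add scale)
  show *: "apply_bcontfun (bcont_op T x) = T x" for x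
    by (simp add: bcont_op_def bounded_linear_Blinfun_apply[OF bl] B)
  show "norm (bcont_op T) \<le> C" if "0 \<le> C"
    by (rule norm_blinfun_bound[OF that], rule norm_bound) (use C in \<open>simp add: *\<close>)
qed

lemma abs_bcontfun_le: "\<bar>apply_bcontfun f x\<bar> \<le> norm (f :: 'a::topological_space \<Rightarrow>\<^sub>C real)"
  using norm_bounded[of f x] by simp

lemma torus_integrable_bcontfun [simp]: "integrable torus_measure (\<lambda>p. apply_bcontfun f p :: real)"
  by (rule torus_integrable[where C = "norm f"]) (auto simp: abs_bcontfun_le)

lemma
  fixes f :: two_body
  shows torus_integrable_bcontfun_left [simp]: "integrable torus_measure (\<lambda>s. f (p, s))"
    and torus_integrable_bcontfun_right [simp]: "integrable torus_measure (\<lambda>s. f (s, p))"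
  by (rule torus_integrable[where C = "norm f"]; auto simp: abs_bcontfun_le intro!: continuous_intros)+

lemma abs_torus_mean_le:
  assumes "integrable torus_measure f" "\<And>p. \<bar>f p\<bar> \<le> C"
  shows "\<bar>torus_mean f\<bar> \<le> C"
proof -
  have "f p \<le> C" "- C \<le> f p" for p using assms(2)[of p] by auto
  then show ?thesis
    using torus_mean_mono[of f "\<lambda>_. C"] torus_mean_mono[of "\<lambda>_. - C" f] assms(1) by simp
qed

lemma continuous_on_torus_mean:
  fixes f :: "'a::metric_space \<times> real3 \<Rightarrow> real"
  assumes f: "continuous_on UNIV f" "\<And>x. \<bar>f x\<bar> \<le> C"
  shows "continuous_on UNIV (\<lambda>p. torus_mean (\<lambda>s. f (p, s)))"
proof (rule continuous_on_sequentiallyI)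
  fix u :: "nat \<Rightarrow> 'a" and a assume u: "u \<longlonglongrightarrow> a"
  have c: "continuous_on UNIV (\<lambda>s. f (p, s))" for p
    by (rule continuous_on_compose2[OF f(1)]) (auto intro!: continuous_intros)
  have "(\<lambda>n. \<integral>s. f (u n, s) \<partial>torus_measure) \<longlonglongrightarrow> (\<integral>s. f (a, s) \<partial>torus_measure)"
  proof (rule integral_dominated_convergence[where w = "\<lambda>_. C"])
    show "AE s in torus_measure. (\<lambda>n. f (u n, s)) \<longlonglongrightarrow> f (a, s)"
    proof (rule AE_I2)
      show "(\<lambda>n. f (u n, s)) \<longlonglongrightarrow> f (a, s)" for s
        by (rule continuous_on_tendsto_compose[OF f(1)]) (auto intro!: tendsto_intros u)
    qed
  qed (use f(2) borel_measurable_torus[OF c] in auto)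
  then show "(\<lambda>n. torus_mean (\<lambda>s. f (u n, s))) \<longlonglongrightarrow> torus_mean (\<lambda>s. f (a, s))"
    unfolding torus_mean_def by (intro tendsto_intros) auto
qed

lemma
  fixes f :: two_body
  shows continuous_on_torus_mean_left: "continuous_on UNIV (\<lambda>p. torus_mean (\<lambda>s. f (p, s)))"
    and continuous_on_torus_mean_right: "continuous_on UNIV (\<lambda>p. torus_mean (\<lambda>s. f (s, p)))"
proof -
  show "continuous_on UNIV (\<lambda>p. torus_mean (\<lambda>s. f (p, s)))"
    by (rule continuous_on_torus_mean[where C = "norm f"]) (auto simp: abs_bcontfun_le)
  show "continuous_on UNIV (\<lambda>p. torus_mean (\<lambda>s. f (s, p)))"
    using continuous_on_torus_mean[where C = "norm f" and f = "\<lambda>x. f (snd x, fst x)"]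
    by (simp add: abs_bcontfun_le continuous_intros)
qed

section \<open>Integration over two copies of the torus\<close>

interpretation torus2: pair_sigma_finite torus_measure torus_measure
  by unfold_locales

interpretation torus2: finite_measure torus2_measure
  by (rule finite_measure_pair_measure) unfold_locales

lemma borel_measurable_torus2:
  fixes g :: "real3 \<times> real3 \<Rightarrow> 'b::{second_countable_topology, metric_space}"
  assumes "continuous_on UNIV g" shows "g \<in> borel_measurable torus2_measure"
proof -
  have "g \<in> borel_measurable (borel \<Otimes>\<^sub>M borel)"
    unfolding borel_prod by (rule borel_measurable_continuous_onI[OF assms])
  moreover have "(\<lambda>x. x) \<in> measurable torus_measure borel"
    by (rule borel_measurable_torus) (rule continuous_on_id)
  ultimately have "(\<lambda>x. g (fst x, snd x)) \<in> borel_measurable torus2_measure" by measurable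
  then show ?thesis by simp
qed

lemma torus2_integrable:
  fixes g :: "real3 \<times> real3 \<Rightarrow> real"
  assumes "continuous_on UNIV g" "\<And>x. \<bar>g x\<bar> \<le> C"
  shows "integrable torus2_measure g"
  using assms by (intro torus2.integrable_bounded borel_measurable_torus2) auto

lemma
  fixes g :: "real3 \<times> real3 \<Rightarrow> real"
  assumes "continuous_on UNIV g" "\<And>x. \<bar>g x\<bar> \<le> C"
  shows torus2_integral: "(\<integral>x. g x \<partial>torus2_measure)
      = ((2 * pi) ^ 3)\<^sup>2 * torus_mean (\<lambda>p. torus_mean (\<lambda>q. g (p, q)))"
    and torus_mean_swap: "torus_mean (\<lambda>p. torus_mean (\<lambda>q. g (p, q))) = torus_mean (\<lambda>q. torus_mean (\<lambda>p. g (p, q)))"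
proof -
  have i: "integrable torus2_measure g" by (rule torus2_integrable[OF assms])
  show "(\<integral>x. g x \<partial>torus2_measure) = ((2 * pi) ^ 3)\<^sup>2 * torus_mean (\<lambda>p. torus_mean (\<lambda>q. g (p, q)))"
    using torus2.integral_fst'[OF i] by (simp add: torus_mean_def power2_eq_square)
  have "(\<integral>q. (\<integral>p. g (p, q) \<partial>torus_measure) \<partial>torus_measure) = (\<integral>p. (\<integral>q. g (p, q) \<partial>torus_measure) \<partial>torus_measure)"
    by (rule torus2.Fubini_integral) (use i in simp)
  then show "torus_mean (\<lambda>p. torus_mean (\<lambda>q. g (p, q))) = torus_mean (\<lambda>q. torus_mean (\<lambda>p. g (p, q)))"
    by (simp add: torus_mean_def)
qed

text \<open>On antisymmetric functions this is the partial mean over the second variable. It ignores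
  symmetric parts and inverts \<open>lift\<close> on functions of mean zero, so that
  \<open>lift o\<^sub>L reduce\<close> is the projection P.\<close>

definition reduce :: "two_body \<Rightarrow>\<^sub>L one_body" where
  "reduce = bcont_op (\<lambda>(f :: two_body) p. (torus_mean (\<lambda>s. f (p, s)) - torus_mean (\<lambda>s. f (s, p))) / 2)"

definition lift :: "one_body \<Rightarrow>\<^sub>L two_body" where
  "lift = bcont_op (\<lambda>(\<phi> :: one_body) x. \<phi> (fst x) - \<phi> (snd x))"

definition antisymm :: "two_body \<Rightarrow>\<^sub>L two_body" where
  "antisymm = bcont_op (\<lambda>(f :: two_body) x. (f x - f (snd x, fst x)) / 2)"

definition mult_op :: "('a::topological_space \<Rightarrow> real) \<Rightarrow> ('a \<Rightarrow>\<^sub>C real) \<Rightarrow>\<^sub>L ('a \<Rightarrow>\<^sub>C real)" where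
  "mult_op g = bcont_op (\<lambda>f x. g x * apply_bcontfun f x)"

definition trig :: "real3 \<Rightarrow> real3 \<Rightarrow>\<^sub>L one_body" where
  "trig \<alpha> = bcont_op (\<lambda>c p. \<Sum>i\<in>UNIV. c $ i * cos (p $ i - \<alpha> $ i))"

text \<open>The factor 2 compensates the mean 1/2 of a squared cosine and makes
  \<open>coeff \<alpha>\<close> a left inverse of \<open>trig \<alpha>\<close>.\<close>

definition coeff :: "real3 \<Rightarrow> one_body \<Rightarrow>\<^sub>L real3" where
  "coeff \<alpha> = Blinfun (\<lambda>\<phi> :: one_body. \<chi> i. 2 * torus_mean (\<lambda>p. cos (p $ i - \<alpha> $ i) * \<phi> p))"

section \<open>Pointwise formulas and norm bounds for these operators\<close>

lemma reduce_apply: "reduce f p = (torus_mean (\<lambda>s. f (p, s)) - torus_mean (\<lambda>s. f (s, p))) / 2"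
  and norm_reduce: "norm reduce \<le> 1"
proof -
  note * = continuous_on_torus_mean_left continuous_on_torus_mean_right
  have b: "\<bar>(torus_mean (\<lambda>s. f (p, s)) - torus_mean (\<lambda>s. f (s, p))) / 2\<bar> \<le> 1 * norm f" for f :: two_body and p
    using abs_torus_mean_le[of "\<lambda>s. f (p, s)" "norm f"] abs_torus_mean_le[of "\<lambda>s. f (s, p)" "norm f"]
    by (simp add: abs_bcontfun_le)
  have c: "continuous_on UNIV (\<lambda>p. (torus_mean (\<lambda>s. f (p, s)) - torus_mean (\<lambda>s. f (s, p))) / 2)"
    for f :: two_body
    by (intro continuous_intros *) simp
  have add: "(torus_mean (\<lambda>s. (f + g) (p, s)) - torus_mean (\<lambda>s. (f + g) (s, p))) / 2
      = (torus_mean (\<lambda>s. f (p, s)) - torus_mean (\<lambda>s. f (s, p))) / 2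
        + (torus_mean (\<lambda>s. g (p, s)) - torus_mean (\<lambda>s. g (s, p))) / 2" for f g :: two_body and p
    by (simp add: torus_mean_add field_simps)
  have scale: "(torus_mean (\<lambda>s. (r *\<^sub>R f) (p, s)) - torus_mean (\<lambda>s. (r *\<^sub>R f) (s, p))) / 2
      = r * ((torus_mean (\<lambda>s. f (p, s)) - torus_mean (\<lambda>s. f (s, p))) / 2)" for r and f :: two_body and p
    by (simp add: algebra_simps)
  show "reduce f p = (torus_mean (\<lambda>s. f (p, s)) - torus_mean (\<lambda>s. f (s, p))) / 2"
    unfolding reduce_def by (rule fun_cong[OF bcont_op_apply[OF c add scale b]])
  show "norm reduce \<le> 1"
    unfolding reduce_def by (rule norm_bcont_op[OF c add scale b]) simp
qed

lemma lift_apply: "lift \<phi> x = \<phi> (fst x) - \<phi> (snd x)" and norm_lift: "norm lift \<le> 2"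
proof -
  have b: "\<bar>\<phi> (fst x) - \<phi> (snd x)\<bar> \<le> 2 * norm \<phi>" for \<phi> :: "one_body" and x
    using abs_bcontfun_le[of \<phi> "fst x"] abs_bcontfun_le[of \<phi> "snd x"] by simp
  show "lift \<phi> x = \<phi> (fst x) - \<phi> (snd x)" unfolding lift_def
    by (subst bcont_op_apply[where C = 2]) (use b in \<open>auto intro!: continuous_intros simp: algebra_simps\<close>)
  show "norm lift \<le> 2" unfolding lift_def
    by (rule norm_bcont_op) (use b in \<open>auto intro!: continuous_intros simp: algebra_simps\<close>)
qed

lemma antisymm_apply: "antisymm f x = (f x - f (snd x, fst x)) / 2" and norm_antisymm: "norm antisymm \<le> 1"
proof -
  have b: "\<bar>(f x - f (snd x, fst x)) / 2\<bar> \<le> 1 * norm f" for f :: two_body and x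
    using abs_bcontfun_le[of f x] abs_bcontfun_le[of f "(snd x, fst x)"] by simp
  show "antisymm f x = (f x - f (snd x, fst x)) / 2" unfolding antisymm_def
    by (subst bcont_op_apply[where C = 1])
      (use b in \<open>auto intro!: continuous_intros simp: field_simps\<close>)
  show "norm antisymm \<le> 1" unfolding antisymm_def
    by (rule norm_bcont_op)
      (use b in \<open>auto intro!: continuous_intros simp: field_simps\<close>)
qed

lemma
  assumes "continuous_on UNIV g" "\<And>x. \<bar>g x\<bar> \<le> C"
  shows mult_apply: "mult_op g f x = g x * f x" and norm_mult_op: "norm (mult_op g) \<le> C"
proof -
  have b: "\<bar>g x * f x\<bar> \<le> C * norm f" for f :: "'a \<Rightarrow>\<^sub>C real" and x
    unfolding abs_mult using assms(2)[of x] by (intro mult_mono abs_bcontfun_le) auto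
  show "mult_op g f x = g x * f x" unfolding mult_op_def
    by (subst bcont_op_apply[where C = C]) (use b assms in \<open>auto intro!: continuous_intros simp: algebra_simps\<close>)
  show "norm (mult_op g) \<le> C" unfolding mult_op_def
    by (rule norm_bcont_op)
      (use b assms(1) assms(2)[of undefined] in \<open>auto intro!: continuous_intros simp: algebra_simps\<close>)
qed

lemma trig_apply: "trig \<alpha> c p = (\<Sum>i\<in>UNIV. c $ i * cos (p $ i - \<alpha> $ i))" and norm_trig: "norm (trig \<alpha>) \<le> 3"
proof -
  have b: "\<bar>\<Sum>i\<in>UNIV. c $ i * cos (p $ i - \<alpha> $ i)\<bar> \<le> 3 * norm c" for c p
  proof -
    have "\<bar>\<Sum>i\<in>UNIV. c $ i * cos (p $ i - \<alpha> $ i)\<bar> \<le> (\<Sum>i\<in>(UNIV :: 3 set). norm c)"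
    proof (intro order_trans[OF sum_abs] sum_mono)
      show "\<bar>c $ i * cos (p $ i - \<alpha> $ i)\<bar> \<le> norm c" for i
        unfolding abs_mult using mult_mono[OF component_le_norm_cart[of c i] abs_cos_le_one] by simp
    qed
    then show ?thesis by simp
  qed
  have s: "(\<Sum>i\<in>UNIV. (c + d) $ i * cos (p $ i - \<alpha> $ i))
      = (\<Sum>i\<in>UNIV. c $ i * cos (p $ i - \<alpha> $ i)) + (\<Sum>i\<in>UNIV. d $ i * cos (p $ i - \<alpha> $ i))" for c d p
    by (simp add: sum.distrib algebra_simps)
  have r: "(\<Sum>i\<in>UNIV. (r *\<^sub>R c) $ i * cos (p $ i - \<alpha> $ i))
      = r * (\<Sum>i\<in>UNIV. c $ i * cos (p $ i - \<alpha> $ i))" for r c p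
    by (simp add: sum_distrib_left algebra_simps)
  have c: "continuous_on UNIV (\<lambda>p. \<Sum>i\<in>UNIV. c $ i * cos (p $ i - \<alpha> $ i))" for c
    by (intro continuous_intros)
  show "trig \<alpha> c p = (\<Sum>i\<in>UNIV. c $ i * cos (p $ i - \<alpha> $ i))" unfolding trig_def
    by (rule fun_cong[OF bcont_op_apply[OF c s r b]])
  show "norm (trig \<alpha>) \<le> 3" unfolding trig_def
    by (rule norm_bcont_op[OF c s r b]) simp
qed

lemma torus_integrable_cos_bcontfun [simp]:
  "integrable torus_measure (\<lambda>p. cos (p $ i - \<theta>) * apply_bcontfun \<phi> p)" (is ?A)
  and abs_torus_mean_cos_le: "\<bar>torus_mean (\<lambda>p. cos (p $ i - \<theta>) * apply_bcontfun \<phi> p)\<bar> \<le> norm \<phi>" (is ?B)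
proof -
  have b: "\<bar>cos (p $ i - \<theta>) * apply_bcontfun \<phi> p\<bar> \<le> norm \<phi>" for p
    unfolding abs_mult using mult_mono[OF abs_cos_le_one abs_bcontfun_le] by fastforce
  show ?A by (rule torus_integrable[where C = "norm \<phi>"]) (use b in \<open>auto intro!: continuous_intros\<close>)
  then show ?B using b by (rule abs_torus_mean_le)
qed

lemma coeff_apply: "coeff \<alpha> \<phi> = (\<chi> i. 2 * torus_mean (\<lambda>p. cos (p $ i - \<alpha> $ i) * \<phi> p))"
  and norm_coeff: "norm (coeff \<alpha>) \<le> 6"
proof -
  let ?T = "\<lambda>\<phi>. \<chi> i. 2 * torus_mean (\<lambda>p. cos (p $ i - \<alpha> $ i) * apply_bcontfun \<phi> p)"
  have b: "norm (?T \<phi>) \<le> norm \<phi> * 6" for \<phi>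
  proof -
    have "norm (?T \<phi>) \<le> (\<Sum>i\<in>UNIV. \<bar>?T \<phi> $ i\<bar>)" by (rule norm_le_l1_cart)
    also have "\<dots> \<le> (\<Sum>i\<in>(UNIV :: 3 set). 2 * norm \<phi>)"
      using abs_torus_mean_cos_le by (intro sum_mono) (simp add: abs_mult)
    finally show ?thesis by simp
  qed
  have bl: "bounded_linear ?T"
    by (rule bounded_linear_intro[OF _ _ b])
      (simp_all add: vec_eq_iff distrib_left torus_mean_add mult.left_commute)
  show *: "coeff \<alpha> \<phi> = ?T \<phi>" for \<phi>
    unfolding coeff_def by (simp add: bounded_linear_Blinfun_apply[OF bl])
  show "norm (coeff \<alpha>) \<le> 6"
    by (rule norm_blinfun_bound) (use b in \<open>simp_all add: * mult.commute\<close>)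
qed

section \<open>Algebraic relations between these operators\<close>

lemma torus_mean_reduce [simp]: "torus_mean (\<lambda>p. reduce f p) = 0"
proof -
  have "torus_mean (\<lambda>p. torus_mean (\<lambda>s. f (p, s))) = torus_mean (\<lambda>p. torus_mean (\<lambda>s. f (s, p)))"
    by (rule torus_mean_swap[where C = "norm f"]) (auto simp: abs_bcontfun_le)
  moreover have "integrable torus_measure (\<lambda>p. torus_mean (\<lambda>s. f (p, s)))"
      "integrable torus_measure (\<lambda>p. torus_mean (\<lambda>s. f (s, p)))"
    by (rule torus_integrable[where C = "norm f"];
        auto intro!: abs_torus_mean_le continuous_on_torus_mean_left continuous_on_torus_mean_right
          simp: abs_bcontfun_le)+
  ultimately show ?thesis by (simp add: reduce_apply torus_mean_diff)
qed

lemma reduce_lift: "reduce (lift \<phi>) p = \<phi> p - torus_mean \<phi>"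
  by (simp add: reduce_apply lift_apply torus_mean_diff)

lemma reduce_lift_reduce [simp]: "reduce (lift (reduce f)) = reduce f"
  by (rule bcontfun_eqI) (simp add: reduce_lift)

lemma torus_mean_trig [simp]: "torus_mean (\<lambda>p. trig \<alpha> c p) = 0"
proof -
  have "integrable torus_measure (\<lambda>p. c $ i * cos (p $ i - \<alpha> $ i))" for i
    by (rule torus_integrable[where C = "\<bar>c $ i\<bar>"])
      (auto intro!: continuous_intros simp: abs_mult mult_left_le)
  then show ?thesis by (simp add: trig_apply torus_mean_sum)
qed

lemma reduce_lift_trig [simp]: "reduce (lift (trig \<alpha> c)) = trig \<alpha> c"
  by (rule bcontfun_eqI) (simp add: reduce_lift)

lemma coeff_trig: "coeff \<alpha> (trig \<beta> c) = (\<chi> i. cos (\<alpha> $ i - \<beta> $ i) * c $ i)"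
proof -
  have "torus_mean (\<lambda>p. cos (p $ i - \<alpha> $ i) * trig \<beta> c p) = cos (\<alpha> $ i - \<beta> $ i) / 2 * c $ i" for i
  proof -
    have int: "integrable torus_measure (\<lambda>p. c $ j * (cos (p $ i - \<alpha> $ i) * cos (p $ j - \<beta> $ j)))" for j
      by (rule torus_integrable[where C = "\<bar>c $ j\<bar>"])
        (auto intro!: continuous_intros mult_left_le mult_le_one simp: abs_mult)
    have "torus_mean (\<lambda>p. cos (p $ i - \<alpha> $ i) * trig \<beta> c p)
        = torus_mean (\<lambda>p. \<Sum>j\<in>UNIV. c $ j * (cos (p $ i - \<alpha> $ i) * cos (p $ j - \<beta> $ j)))"
      by (simp add: trig_apply sum_distrib_left algebra_simps)
    also have "\<dots> = (\<Sum>j\<in>UNIV. c $ j * (if i = j then cos (\<alpha> $ i - \<beta> $ j) / 2 else 0))"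
      using int by (simp add: torus_mean_sum torus_mean_cos_cos)
    also have "\<dots> = (\<Sum>j\<in>UNIV. if i = j then c $ i * (cos (\<alpha> $ i - \<beta> $ i) / 2) else 0)"
      by (intro sum.cong) auto
    finally show ?thesis by simp
  qed
  then show ?thesis by (simp add: coeff_apply vec_eq_iff mult.commute)
qed

lemma coeff_trig_same [simp]: "coeff \<alpha> (trig \<alpha> c) = c"
  by (simp add: coeff_trig vec_eq_iff)

lemma antisym_lift [simp]: "antisymm (lift \<phi>) = lift \<phi>"
  by (rule bcontfun_eqI) (simp add: antisymm_apply lift_apply)

lemma reduce_antisym [simp]: "reduce (antisymm f) = reduce f"
  by (rule bcontfun_eqI) (simp add: reduce_apply antisymm_apply torus_mean_diff diff_divide_distrib)

lemma antisym_idem [simp]: "antisymm (antisymm f) = antisymm f"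
  by (rule bcontfun_eqI) (simp add: antisymm_apply field_simps)

section \<open>Three-dimensional invariant subspaces\<close>

lemma norm_compose_le:
  assumes "norm f \<le> a" "norm g \<le> b" shows "norm (f o\<^sub>L g) \<le> a * b"
  using norm_blinfun_compose[of f g] mult_mono[OF assms] assms(1) norm_ge_zero[of f] norm_ge_zero[of g]
  by (smt (verit))

lemma norm_scaleR_le: "norm x \<le> b \<Longrightarrow> norm (r *\<^sub>R x) \<le> \<bar>r\<bar> * b"
  by (simp add: mult_left_mono)

lemma antisymm_mult_op:
  assumes "continuous_on UNIV g" "\<And>x. \<bar>g x\<bar> \<le> C" "\<And>p q. g (p, q) = g (q, p)"
  shows "antisymm (mult_op g f) = mult_op g (antisymm f)"
  by (rule bcontfun_eqI, rename_tac x, case_tac x)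
    (simp add: antisymm_apply mult_apply[OF assms(1,2)] assms(3) right_diff_distrib)

text \<open>By the addition formula, \<open>cos (K $ i - p $ i - s $ i)\<close> is a difference of
  two products of a function of \<open>p\<close> and a function of \<open>s\<close>, so the integral
  operator has finite rank. The shift \<open>\<alpha>\<close> and the sign \<open>\<sigma>\<close>
  let either the cosine or the sine triple take the place of \<open>trig \<alpha>\<close>;
  \<open>\<beta>\<close> denotes the other one.\<close>

lemma reduce_mult_eps:
  fixes \<phi> :: one_body and K \<alpha> \<beta> :: real3 and \<sigma> :: real
  assumes K: "\<And>i x. cos (K $ i - x) = - \<sigma> * cos (x - 2 * \<alpha> $ i)"
    and \<beta>: "\<And>i. \<beta> $ i = \<alpha> $ i + pi / 2" and mean: "torus_mean \<phi> = 0"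
  shows "reduce (mult_op (\<lambda>x. eps (K - fst x - snd x)) (lift \<phi>))
    = 3 *\<^sub>R \<phi> + (\<sigma> / 2) *\<^sub>R (trig \<beta> (coeff \<beta> \<phi>) - trig \<alpha> (coeff \<alpha> \<phi>))" (is "?l = ?r")
proof (rule bcontfun_eqI)
  fix p
  let ?e = "\<lambda>x :: real3 \<times> real3. eps (K - fst x - snd x)"
  have e: "continuous_on UNIV ?e" "\<bar>?e x\<bar> \<le> 6" for x
    using eps_bounds by (auto intro!: continuous_intros)
  have ei: "integrable torus_measure (\<lambda>s. eps (K - p - s))"
    by (rule torus_integrable[where C = 6]) (auto intro!: continuous_intros simp: eps_bounds)
  have es: "eps (K - p - s) = 3 - (\<Sum>i\<in>UNIV. \<sigma> * (cos (p $ i - \<beta> $ i) * cos (s $ i - \<beta> $ i)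
      - cos (p $ i - \<alpha> $ i) * cos (s $ i - \<alpha> $ i)))" for s
  proof -
    have "cos ((K - p - s) $ i) = \<sigma> * (cos (p $ i - \<beta> $ i) * cos (s $ i - \<beta> $ i)
        - cos (p $ i - \<alpha> $ i) * cos (s $ i - \<alpha> $ i))" for i
    proof -
      have "cos ((K - p - s) $ i) = - \<sigma> * cos ((p $ i - \<alpha> $ i) + (s $ i - \<alpha> $ i))"
        using K[of i "p $ i + s $ i"] by (simp add: algebra_simps)
      moreover have "cos (y - \<beta> $ i) = sin (y - \<alpha> $ i)" for y
        using cos_diff[of "y - \<alpha> $ i" "pi / 2"] by (simp add: \<beta> algebra_simps)
      ultimately show ?thesis unfolding cos_add by (simp add: algebra_simps)
    qed
    then show ?thesis by (simp add: eps_def sum_subtractf)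
  qed
  have i1: "integrable torus_measure (\<lambda>s. eps (K - p - s) * \<phi> s)"
    by (rule torus_integrable[where C = "6 * norm \<phi>"])
      (auto intro!: continuous_intros mult_mono simp: abs_mult abs_bcontfun_le eps_bounds)
  have "reduce (mult_op ?e (lift \<phi>)) p = torus_mean (\<lambda>s. eps (K - p - s) * \<phi> p - eps (K - p - s) * \<phi> s)"
  proof -
    have 1: "K - s - p = K - p - s" for s by simp
    have 2: "torus_mean (\<lambda>s. eps (K - p - s) * (\<phi> s - \<phi> p)) = - torus_mean (\<lambda>s. eps (K - p - s) * (\<phi> p - \<phi> s))"
      using torus_mean_cmult[of "-1" "\<lambda>s. eps (K - p - s) * (\<phi> p - \<phi> s)"]
      by (simp add: algebra_simps del: torus_mean_cmult)
    show ?thesis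
      by (simp add: reduce_apply mult_apply[OF e] lift_apply 1 2 del: torus_mean_multc)
        (simp add: algebra_simps)
  qed
  also have "\<dots> = 3 * \<phi> p - torus_mean (\<lambda>s. eps (K - p - s) * \<phi> s)"
    using ei i1 by (simp add: torus_mean_diff torus_mean_eps)
  also have "torus_mean (\<lambda>s. eps (K - p - s) * \<phi> s)
      = torus_mean (\<lambda>s. 3 * \<phi> s - (\<Sum>i\<in>UNIV. \<sigma> * (cos (p $ i - \<beta> $ i) * (cos (s $ i - \<beta> $ i) * \<phi> s)
        - cos (p $ i - \<alpha> $ i) * (cos (s $ i - \<alpha> $ i) * \<phi> s))))"
    unfolding es by (simp add: left_diff_distrib sum_distrib_left algebra_simps)
  also have "\<dots> = - (\<Sum>i\<in>UNIV. \<sigma> * (cos (p $ i - \<beta> $ i) * torus_mean (\<lambda>s. cos (s $ i - \<beta> $ i) * \<phi> s)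
        - cos (p $ i - \<alpha> $ i) * torus_mean (\<lambda>s. cos (s $ i - \<alpha> $ i) * \<phi> s)))"
    using mean by (simp add: torus_mean_diff torus_mean_sum)
  also have "3 * \<phi> p - \<dots> = ?r p"
    by (simp add: trig_apply coeff_apply sum_distrib_left sum_subtractf algebra_simps)
  finally show "?l p = ?r p" .
qed

text \<open>
  The operator \<open>H\<close> is conjugated with \<open>P + \<gamma> Q\<close>, where \<open>Q\<close> is the projection complementary to \<open>P\<close>. This divides the
  coupling from \<open>Q\<close> to \<open>P\<close>, which is of order \<open>\<gamma>\<close>, by \<open>\<gamma>\<close>; the coupling from \<open>P\<close> to \<open>Q\<close> grows, but is compensated
  by the resolvent of \<open>H\<close> on the range of \<open>Q\<close>, which is of order \<open>1 / \<lambda>\<close>. The choice \<open>\<sigma> = 1\<close> yields the lower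
  and \<open>\<sigma> = -1\<close> the upper triple.
\<close>

lemma invariant_subspace:
  fixes K \<alpha> :: real3 and \<gamma> lam \<sigma> :: real
  assumes \<gamma>: "\<gamma> \<ge> 2 * 10 ^ 6" and lam: "lam \<ge> 100 * \<gamma> ^ 3" and \<sigma>: "\<bar>\<sigma>\<bar> = 1"
    and K: "\<And>i x. cos (K $ i - x) = - \<sigma> * cos (x - 2 * \<alpha> $ i)"
  defines "m \<equiv> 3 * \<gamma> - lam - \<sigma> * \<gamma> / 2"
  obtains F :: "real3 \<Rightarrow>\<^sub>L two_body" and N :: "real3 \<Rightarrow>\<^sub>L real3"
  where "\<And>c. coeff \<alpha> (reduce (F c)) = c" "\<And>c. antisymm (F c) = F c"
    "\<And>c. mult_op (\<lambda>x. dispersion \<gamma> K (fst x) (snd x)) (F c) - lam *\<^sub>R lift (reduce (F c)) = F (N c)"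
    "\<And>c. norm (N c - m *\<^sub>R c) \<le> 3780 * norm c"
proof -
  define \<beta> :: real3 where "\<beta> = (\<chi> i. \<alpha> $ i + pi / 2)"
  have \<gamma>0: "\<gamma> > 0" using \<gamma> by simp
  have cos\<alpha>\<beta>: "coeff \<alpha> (trig \<beta> c) = 0" "coeff \<beta> (trig \<alpha> c) = 0" for c
    by (simp_all add: coeff_trig \<beta>_def vec_eq_iff)
  define e1 e2 where "e1 = (\<lambda>x. eps (fst x) + eps (snd x))" "e2 = (\<lambda>x. eps (K - fst x - snd x))"
  have e1: "continuous_on UNIV e1" "\<bar>e1 x\<bar> \<le> 12" for x
    using eps_bounds[of "fst x"] eps_bounds[of "snd x"] by (auto simp: e1_e2_def intro!: continuous_intros)
  have e2: "continuous_on UNIV e2" "\<bar>e2 x\<bar> \<le> 6" for x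
    using eps_bounds by (auto simp: e1_e2_def intro!: continuous_intros)
  let ?d = "\<lambda>x. dispersion \<gamma> K (fst x) (snd x)"
  have d: "continuous_on UNIV ?d" "\<bar>?d x\<bar> \<le> 12 + 6 * \<gamma>" for x
    using dispersion_bounds[of \<gamma> K] \<gamma>0 by (auto simp: dispersion_def intro!: continuous_intros)
  define E1 E2 E where "E1 = mult_op e1" "E2 = mult_op e2" "E = mult_op ?d"
  note E_defs = E1_E2_E_def
  have E: "E x = E1 x + \<gamma> *\<^sub>R E2 x" for x
    by (rule bcontfun_eqI)
      (simp add: E_defs mult_apply[OF e1] mult_apply[OF e2] mult_apply[OF d], 
       simp add: e1_e2_def dispersion_def algebra_simps)
  have JE: "antisymm (E x) = E (antisymm x)" "antisymm (E1 x) = E1 (antisymm x)" for x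
    unfolding E_defs by (rule antisymm_mult_op[OF d] antisymm_mult_op[OF e1];
        simp add: dispersion_def e1_e2_def algebra_simps)+
  define P where "P = lift o\<^sub>L reduce"
  define Q where "Q = antisymm - P"
  define u l where "u = lift o\<^sub>L trig \<alpha>" "l = coeff \<alpha> o\<^sub>L reduce"
  define v k where "v = lift o\<^sub>L trig \<beta>" "k = coeff \<beta> o\<^sub>L reduce"
  note ulvk = u_l_def v_k_def
  note app = blinfun_apply_blinfun_compose blinfun.add_left blinfun.diff_left blinfun.scaleR_left
    blinfun.add_right blinfun.diff_right blinfun.scaleR_right blinfun.zero_right
  have alg: "P (P x) = P x" "P (antisymm x) = P x" "antisymm (P x) = P x"
    "P (u c) = u c" "P (v c) = v c" "l (P x) = l x" "k (P x) = k x" "l (antisymm x) = l x" "k (antisymm x) = k x"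
    "l (u c) = c" "k (v c) = c" "l (v c) = 0" "k (u c) = 0" "antisymm (u c) = u c" "antisymm (v c) = v c"
    "P (Q x) = 0" "Q (P x) = 0" "Q (Q x) = Q x" "l (Q x) = 0" "k (Q x) = 0" "Q (u c) = 0" "Q (v c) = 0"
    "antisymm (Q x) = Q x" for x c
    by (simp_all add: P_def Q_def ulvk app cos\<alpha>\<beta>)
  have PE2P: "P (E2 (P x)) = 3 *\<^sub>R P x + (\<sigma> / 2) *\<^sub>R (v (k x) - u (l x))" for x
    using reduce_mult_eps[OF K, of \<beta> "reduce x"]
    by (simp add: P_def E_defs e1_e2_def ulvk app \<beta>_def)
  \<comment> \<open>On the range of \<open>P\<close>, \<open>L0 - m\<close> is
    \<open>\<sigma> * \<gamma>\<close> on the range of \<open>v\<close> and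
    \<open>\<sigma> * \<gamma> / 2\<close> on what remains beside the ranges of \<open>u\<close> and
    \<open>v\<close>. The second term corrects the factor \<open>2 / (\<sigma> * \<gamma>)\<close>
    to \<open>1 / (\<sigma> * \<gamma>)\<close> on the range of \<open>v\<close>.\<close>
  define S1 where "S1 = (2 / (\<sigma> * \<gamma>)) *\<^sub>R (P - (u o\<^sub>L l)) - (1 / (\<sigma> * \<gamma>)) *\<^sub>R (v o\<^sub>L k)"
  \<comment> \<open>This is \<open>- 1 / m\<close>, the resolvent of \<open>L0\<close> at
    \<open>m\<close> on the range of \<open>Q\<close>, where \<open>L0\<close> vanishes.\<close>
  define r where "r = 1 / (lam - 3 * \<gamma> + \<sigma> * \<gamma> / 2)"
  define S where "S = S1 + r *\<^sub>R Q"
  \<comment> \<open>\<open>L0\<close> is the part of P H P with an explicit spectrum. The bounded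
    \<open>E1\<close> and the whole block \<open>Q E Q\<close>, in which \<open>lam\<close> does not
    occur, are left to \<open>B\<close>.\<close>
  define L0 where "L0 = (3 * \<gamma> - lam) *\<^sub>R P + (\<sigma> * \<gamma> / 2) *\<^sub>R ((v o\<^sub>L k) - (u o\<^sub>L l))"
  define B1 where "B1 = (P o\<^sub>L (E1 o\<^sub>L P)) + (1 / \<gamma>) *\<^sub>R (P o\<^sub>L (E o\<^sub>L Q))"
  define B2 where "B2 = \<gamma> *\<^sub>R (Q o\<^sub>L (E o\<^sub>L P)) + (Q o\<^sub>L (E o\<^sub>L Q))"
  define B where "B = B1 + B2"
  \<comment> \<open>On antisymmetric functions this inverts the conjugating operator P + \<gamma>
    Q.\<close>
  define Di where "Di = P + (1 / \<gamma>) *\<^sub>R Q"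
  have \<sigma>2: "\<sigma> * \<sigma> = 1" "\<sigma> \<noteq> 0" using \<sigma> by (auto simp: abs_if split: if_splits)
  have \<gamma>3: "\<gamma> ^ 3 \<ge> \<gamma>" using \<gamma> power_increasing[of 1 3 \<gamma>] by simp
  have \<sigma>\<gamma>: "\<bar>\<sigma> * \<gamma>\<bar> = \<gamma>" using \<sigma> \<gamma>0 by (simp add: abs_mult)
  have mlow: "lam - 3 * \<gamma> + \<sigma> * \<gamma> / 2 \<ge> 96 * \<gamma> ^ 3"
    using \<sigma>\<gamma> \<gamma>3 lam \<gamma>0 by linarith
  have r0: "0 < r" "r \<le> 1 / (96 * \<gamma> ^ 3)" "r * m = - 1"
  proof -
    have p: "0 < 96 * \<gamma> ^ 3" using \<gamma>0 by simp
    have q: "0 < lam - 3 * \<gamma> + \<sigma> * \<gamma> / 2" using p mlow by linarith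
    show "0 < r" unfolding r_def using q by (rule divide_pos_pos[OF zero_less_one])
    show "r \<le> 1 / (96 * \<gamma> ^ 3)" unfolding r_def by (rule frac_le[OF _ _ p mlow]) simp_all
    have "m = - (lam - 3 * \<gamma> + \<sigma> * \<gamma> / 2)" by (simp add: m_def)
    then show "r * m = - 1" using q unfolding r_def by (simp add: divide_simps)
  qed

  have nP: "norm P \<le> 2" unfolding P_def using norm_compose_le[OF norm_lift norm_reduce] by simp
  have nQ: "norm Q \<le> 3" unfolding Q_def
    using norm_triangle_ineq4[of antisymm P] nP norm_antisymm by simp
  have nu: "norm u \<le> 6" "norm v \<le> 6" and nl: "norm l \<le> 6" "norm k \<le> 6"
    unfolding ulvk using norm_compose_le[OF norm_lift norm_trig] norm_compose_le[OF norm_coeff norm_reduce]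
    by simp_all
  have nE1: "norm E1 \<le> 12" unfolding E_defs by (rule norm_mult_op[OF e1])
  have nE: "norm E \<le> 7 * \<gamma>"
    using norm_mult_op[OF d] \<gamma> unfolding E_defs by simp
  have nul: "norm (u o\<^sub>L l) \<le> 36" "norm (v o\<^sub>L k) \<le> 36"
    using norm_compose_le[OF nu(1) nl(1)] norm_compose_le[OF nu(2) nl(2)] by simp_all
  have nS1: "norm S1 \<le> 112 / \<gamma>"
  proof -
    have "norm (P - (u o\<^sub>L l)) \<le> 38" using norm_triangle_ineq4[of P "u o\<^sub>L l"] nP nul(1) by simp
    from norm_scaleR_le[OF this, of "2 / (\<sigma> * \<gamma>)"] norm_scaleR_le[OF nul(2), of "1 / (\<sigma> * \<gamma>)"]
    have "norm S1 \<le> \<bar>2 / (\<sigma> * \<gamma>)\<bar> * 38 + \<bar>1 / (\<sigma> * \<gamma>)\<bar> * 36"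
      unfolding S1_def by (intro norm_triangle_le_diff add_mono)
    then show ?thesis unfolding abs_divide \<sigma>\<gamma> by simp
  qed
  have nB1: "norm B1 \<le> 90"
  proof -
    have "norm (P o\<^sub>L (E1 o\<^sub>L P)) \<le> 2 * (12 * 2)"
      by (intro norm_compose_le nP nE1)
    moreover have "norm ((1 / \<gamma>) *\<^sub>R (P o\<^sub>L (E o\<^sub>L Q))) \<le> \<bar>1 / \<gamma>\<bar> * (2 * (7 * \<gamma> * 3))"
      by (intro norm_scaleR_le norm_compose_le nP nE nQ)
    ultimately show ?thesis unfolding B1_def using \<gamma>0
      by (intro norm_triangle_le) simp
  qed
  have nB2: "norm B2 \<le> 43 * \<gamma>\<^sup>2"
  proof -
    have "norm (\<gamma> *\<^sub>R (Q o\<^sub>L (E o\<^sub>L P))) \<le> \<bar>\<gamma>\<bar> * (3 * (7 * \<gamma> * 2))"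
      by (intro norm_scaleR_le norm_compose_le nP nE nQ)
    also have "\<dots> = 42 * \<gamma>\<^sup>2" using \<gamma>0 by (simp add: power2_eq_square)
    finally have 1: "norm (\<gamma> *\<^sub>R (Q o\<^sub>L (E o\<^sub>L P))) \<le> 42 * \<gamma>\<^sup>2" .
    have 2: "norm (Q o\<^sub>L (E o\<^sub>L Q)) \<le> 3 * (7 * \<gamma> * 3)"
      by (intro norm_compose_le nP nE nQ)
    have "63 * \<gamma> \<le> \<gamma>\<^sup>2" using \<gamma> by (simp add: power2_eq_square mult_right_mono)
    then show ?thesis unfolding B2_def using 1 2
      by (intro norm_triangle_le) linarith
  qed
  have nS: "norm S \<le> 113 / \<gamma>"
  proof -
    have "norm (r *\<^sub>R Q) \<le> 3 * r" using norm_scaleR_le[OF nQ, of r] r0 by simp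
    also have "\<dots> \<le> 3 * (1 / (96 * \<gamma>))"
      using r0(2) \<gamma>3 \<gamma>0 by (intro mult_left_mono order_trans[OF r0(2)] divide_left_mono) auto
    also have "\<dots> \<le> 1 / \<gamma>" using \<gamma>0 by (simp add: divide_simps)
    finally show ?thesis unfolding S_def using nS1
      by (intro norm_triangle_le) (simp add: add_divide_distrib[symmetric])
  qed
  \<comment> \<open>The blocks decouple: \<open>S1\<close> annihilates the range of
    \<open>Q\<close>, and \<open>Q\<close> that of \<open>P\<close>. Thus \<open>B2\<close>, of
    order \<gamma>^2, meets only \<open>r\<close>, of order \<gamma>^(-3); this is where the cubic
    lower bound on \<open>lam\<close> enters.\<close>
  have "S o\<^sub>L B = (S1 o\<^sub>L B1) + r *\<^sub>R B2"
    by (rule blinfun_eqI) (simp add: S_def S1_def B_def B1_def B2_def app alg algebra_simps)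
  moreover have "norm (S1 o\<^sub>L B1) \<le> 112 / \<gamma> * 90" by (rule norm_compose_le[OF nS1 nB1])
  moreover have "norm (r *\<^sub>R B2) \<le> 1 / \<gamma>"
  proof -
    have "norm (r *\<^sub>R B2) \<le> \<bar>r\<bar> * (43 * \<gamma>\<^sup>2)" by (rule norm_scaleR_le[OF nB2])
    also have "\<dots> \<le> 1 / (96 * \<gamma> ^ 3) * (43 * \<gamma>\<^sup>2)" using r0 by (intro mult_right_mono) auto
    also have "\<dots> \<le> 1 / \<gamma>" using \<gamma>0 by (simp add: divide_simps power2_eq_square power3_eq_cube)
    finally show ?thesis .
  qed
  ultimately have nSB: "norm (S o\<^sub>L B) \<le> 10081 / \<gamma>"
    using norm_triangle_ineq[of "S1 o\<^sub>L B1" "r *\<^sub>R B2"] by (simp add: add_divide_distrib[symmetric])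
  have "l o\<^sub>L B = l o\<^sub>L B1"
    by (rule blinfun_eqI) (simp add: B_def B2_def app alg)
  then have nlB: "norm (l o\<^sub>L B) \<le> 540"
    using norm_compose_le[OF nl(1) nB1] by simp
  \<comment> \<open>61020 = 113 * 540 bounds
    \<open>\<gamma> * (norm S * norm (l o\<^sub>L B))\<close> and exceeds the 10081 found for
    \<open>S o\<^sub>L B\<close>. Since \<open>norm u + 3 \<le> 9\<close>, the contraction condition
    forces \<gamma> to be of order 10^6.\<close>
  let ?\<beta> = "61020 / \<gamma>"
  have "\<And>c. l (u c) = c" by (simp add: alg)
  moreover have "\<And>c. L0 (u c) = m *\<^sub>R u c"
    by (simp add: L0_def m_def app alg algebra_simps)
  moreover have "\<And>x. l (S x) = 0"
    by (simp add: S_def S1_def app alg)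
  moreover have "\<And>x. L0 (S x) - m *\<^sub>R S x = antisymm x - u (l x)"
  proof -
    fix x
    define a b where "a = P x - u (l x)" "b = v (k x)"
    have sx: "S x = (2 / (\<sigma> * \<gamma>)) *\<^sub>R a - (1 / (\<sigma> * \<gamma>)) *\<^sub>R b + r *\<^sub>R Q x"
      by (simp add: S_def S1_def a_b_def app)
    have L: "L0 a = (3 * \<gamma> - lam) *\<^sub>R a + (\<sigma> * \<gamma> / 2) *\<^sub>R b" "L0 b = (3 * \<gamma> - lam + \<sigma> * \<gamma> / 2) *\<^sub>R b"
      "L0 (Q x) = 0"
      by (simp_all add: L0_def a_b_def app alg algebra_simps)
    have "L0 (S x) - m *\<^sub>R S x = ((2 / (\<sigma> * \<gamma>)) * (3 * \<gamma> - lam - m)) *\<^sub>R a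
        + ((2 / (\<sigma> * \<gamma>)) * (\<sigma> * \<gamma> / 2) - (1 / (\<sigma> * \<gamma>)) * (3 * \<gamma> - lam + \<sigma> * \<gamma> / 2 - m)) *\<^sub>R b
        - (r * m) *\<^sub>R Q x"
    proof -
      have "s *\<^sub>R (y *\<^sub>R a + h *\<^sub>R b) - t *\<^sub>R (w *\<^sub>R b) + r *\<^sub>R 0 - m *\<^sub>R (s *\<^sub>R a - t *\<^sub>R b + r *\<^sub>R Q x)
          = (s * (y - m)) *\<^sub>R a + (s * h - t * (w - m)) *\<^sub>R b - (r * m) *\<^sub>R Q x" for s t y h w
        by (simp add: algebra_simps)
      then show ?thesis unfolding sx app L .
    qed
    also have "(2 / (\<sigma> * \<gamma>)) * (3 * \<gamma> - lam - m) = 1" using \<sigma>2 \<gamma>0 by (simp add: m_def)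
    also have "(2 / (\<sigma> * \<gamma>)) * (\<sigma> * \<gamma> / 2) - (1 / (\<sigma> * \<gamma>)) * (3 * \<gamma> - lam + \<sigma> * \<gamma> / 2 - m) = 0"
      using \<sigma>2 \<gamma>0 by (simp add: m_def)
    finally show "L0 (S x) - m *\<^sub>R S x = antisymm x - u (l x)"
      by (simp add: r0(3) a_b_def Q_def app)
  qed
  moreover have "\<And>x. antisymm (S x) = S x" by (simp add: S_def S1_def app alg)
  moreover have "\<And>x. antisymm (B x) = B x" by (simp add: B_def B1_def B2_def app alg)
  moreover have "\<And>c. antisymm (u c) = u c" by (simp add: alg)
  moreover have "norm (S o\<^sub>L B) \<le> ?\<beta>" using nSB \<gamma>0 by (simp add: divide_simps)
  moreover have "norm S * norm (l o\<^sub>L B) \<le> ?\<beta>"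
    using mult_mono[OF nS nlB] \<gamma>0 by simp
  moreover have "?\<beta> * (norm u + 3) \<le> 1 / 2"
  proof -
    have "?\<beta> * (norm u + 3) \<le> ?\<beta> * 9" using nu(1) \<gamma>0 by (intro mult_left_mono) auto
    also have "\<dots> \<le> 1 / 2" using \<gamma> by (simp add: divide_simps)
    finally show ?thesis .
  qed
  ultimately obtain W :: "real3 \<Rightarrow>\<^sub>L two_body" where W: "\<And>c. l (W c) = c" "\<And>c. antisymm (W c) = W c" "norm W \<le> norm u + 1"
    "\<And>c. L0 (W c) + B (W c) = m *\<^sub>R W c + W (l (B (W c)))"
    using invariant_graph[of l u L0 m S antisymm B ?\<beta>] by blast
  \<comment> \<open>\<open>Di\<close> intertwines \<open>L0 + B\<close> with H. On antisymmetric
    functions P + Q is the identity, and E preserves antisymmetry, so the four blocks of E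
    reassemble.\<close>
  have inter: "Di (L0 x + B x) = E (Di x) - lam *\<^sub>R P (Di x)" if x: "antisymm x = x" for x
  proof -
    have 1: "L0 x = \<gamma> *\<^sub>R P (E2 (P x)) - lam *\<^sub>R P x"
      unfolding PE2P by (simp add: L0_def app algebra_simps)
    have 2: "L0 x + B x = P (E (P x)) - lam *\<^sub>R P x + (1 / \<gamma>) *\<^sub>R P (E (Q x)) + \<gamma> *\<^sub>R Q (E (P x)) + Q (E (Q x))"
      unfolding 1 by (simp add: B_def B1_def B2_def app E[of "P x"])
    have J: "P (E (P x)) + Q (E (P x)) = E (P x)" "P (E (Q x)) + Q (E (Q x)) = E (Q x)"
      by (simp_all add: Q_def[of] app JE alg)
    have "Di (L0 x + B x) = (P (E (P x)) + Q (E (P x))) - lam *\<^sub>R P x + (1 / \<gamma>) *\<^sub>R (P (E (Q x)) + Q (E (Q x)))"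
      unfolding 2 Di_def using \<gamma>0 by (simp add: app alg algebra_simps)
    then show ?thesis unfolding J by (simp add: Di_def app alg)
  qed
  define F where "F = Di o\<^sub>L W"
  define N where "N = m *\<^sub>R id_blinfun + (l o\<^sub>L (B o\<^sub>L W))"
  show ?thesis
  proof
    show "coeff \<alpha> (reduce (F c)) = c" for c
    proof -
      have "l (F c) = c" by (simp add: F_def Di_def app alg W(1))
      then show ?thesis by (simp add: ulvk app)
    qed
    show "antisymm (F c) = F c" for c by (simp add: F_def Di_def app alg)
    show "mult_op ?d (F c) - lam *\<^sub>R lift (reduce (F c)) = F (N c)" for c
    proof -
      have "E (F c) - lam *\<^sub>R P (F c) = Di (L0 (W c) + B (W c))"
        unfolding F_def blinfun_apply_blinfun_compose by (rule inter[OF W(2), symmetric])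
      also have "\<dots> = F (N c)" unfolding W(4) by (simp add: F_def N_def app)
      finally show ?thesis by (simp add: E_defs P_def app)
    qed
    show "norm (N c - m *\<^sub>R c) \<le> 3780 * norm c" for c
    proof -
      \<comment> \<open>The product 540 * 7 = 3780 does not depend on \<gamma>, so the shift of the
        triple is small against \<gamma> / 2.\<close>
      have "norm W \<le> 7" using W(3) nu(1) by simp
      from norm_compose_le[OF nlB this] have "norm ((l o\<^sub>L B) o\<^sub>L W) \<le> 3780" by simp
      then have "norm (((l o\<^sub>L B) o\<^sub>L W) c) \<le> 3780 * norm c"
        by (meson norm_blinfun order_trans mult_right_mono norm_ge_zero)
      then show ?thesis by (simp add: N_def app)
    qed
  qed
qed

section \<open>Counting eigenvalues\<close>

lemma dim_AE_ge:
  assumes "\<And>i. i < n \<Longrightarrow> f i \<in> W" "independent_AE M n f"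
  shows "enat n \<le> dim_AE M W"
  unfolding dim_AE_def using assms by (intro SUP_upper) auto

lemma independent_AE_reindex:
  assumes f: "independent_AE M n f" and h: "inj_on h {..<k}" "h ` {..<k} \<subseteq> {..<n}"
  shows "independent_AE M k (\<lambda>i. f (h i))"
  unfolding independent_AE_def
proof (intro allI impI)
  fix c :: "nat \<Rightarrow> complex" and j
  assume c: "AE x in M. (\<Sum>i<k. c i * f (h i) x) = 0" and j: "j < k"
  define c' where "c' i = (if i \<in> h ` {..<k} then c (the_inv_into {..<k} h i) else 0)" for i
  have "(\<Sum>i<n. c' i * f i x) = (\<Sum>i<k. c i * f (h i) x)" for x
  proof -
    have "(\<Sum>i<n. c' i * f i x) = (\<Sum>i\<in>h ` {..<k}. c' i * f i x)"
      using h(2) by (intro sum.mono_neutral_right) (auto simp: c'_def)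
    also have "\<dots> = (\<Sum>i<k. c' (h i) * f (h i) x)"
      using h(1) by (simp add: sum.reindex)
    also have "\<dots> = (\<Sum>i<k. c i * f (h i) x)"
      using h(1) by (intro sum.cong) (auto simp: c'_def the_inv_into_f_f)
    finally show ?thesis .
  qed
  then have "AE x in M. (\<Sum>i<n. c' i * f i x) = 0" using c by simp
  then have "\<forall>i<n. c' i = 0" using f unfolding independent_AE_def by blast
  moreover have "h j < n" using h(2) j by auto
  ultimately have "c' (h j) = 0" by blast
  then show "c j = 0" using j h(1) by (simp add: c'_def the_inv_into_f_f)
qed

text \<open>The values \<open>z i\<close> may coincide, so the eigenvectors are grouped by
  eigenvalue: each fibre of \<open>z\<close> bounds the dimension of an eigenspace from below, and
  the fibre sizes add up to \<open>n\<close>.\<close>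

lemma eigenvalue_count_ge:
  assumes f: "\<And>i. i < n \<Longrightarrow> f i \<in> eigenspace M V A (complex_of_real (z i))" "independent_AE M n f"
    and z: "\<And>i. i < n \<Longrightarrow> z i \<in> I"
  shows "enat n \<le> eigenvalue_count M V A I"
proof -
  define F where "F = z ` {..<n}"
  define m where "m t = card {i \<in> {..<n}. z i = t}" for t
  have dim: "enat (m t) \<le> dim_AE M (eigenspace M V A (complex_of_real t))" for t
  proof -
    obtain h where h: "bij_betw h {..<m t} {i \<in> {..<n}. z i = t}"
      using ex_bij_betw_nat_finite[of "{i \<in> {..<n}. z i = t}"]
      unfolding m_def lessThan_atLeast0 by auto
    show ?thesis
    proof (rule dim_AE_ge)
      show "independent_AE M (m t) (\<lambda>i. f (h i))"
        using h by (intro independent_AE_reindex[OF f(2)]) (auto simp: bij_betw_def)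
      show "f (h i) \<in> eigenspace M V A (complex_of_real t)" if "i < m t" for i
      proof -
        have "h i < n \<and> z (h i) = t" using bij_betwE[OF h] that by simp
        then show ?thesis using f(1)[of "h i"] by simp
      qed
    qed
  qed
  have "n = (\<Sum>i<n. 1)" by simp
  also have "\<dots> = (\<Sum>t\<in>F. \<Sum>i\<in>{i \<in> {..<n}. z i = t}. 1)"
    unfolding F_def by (rule sum.image_gen) simp
  also have "\<dots> = (\<Sum>t\<in>F. m t)" by (simp add: m_def)
  finally have "enat n = enat (\<Sum>t\<in>F. m t)" by simp
  also have "\<dots> = (\<Sum>t\<in>F. enat (m t))" by (simp only: of_nat_eq_enat[symmetric] of_nat_sum)
  also have "\<dots> \<le> (\<Sum>t\<in>F. dim_AE M (eigenspace M V A (complex_of_real t)))"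
    by (intro sum_mono dim)
  also have "\<dots> \<le> eigenvalue_count M V A I"
    unfolding eigenvalue_count_def using z by (intro SUP_upper) (auto simp: F_def)
  finally show ?thesis .
qed

section \<open>The Hamiltonian on continuous antisymmetric functions and its symmetry\<close>

abbreviation cfun :: "two_body \<Rightarrow> real3 \<times> real3 \<Rightarrow> complex" where
  "cfun f \<equiv> \<lambda>x. complex_of_real (f x)"

lemma antisymD: "antisymm f = f \<Longrightarrow> f (q, p) = - f (p, q)"
  using antisymm_apply[of f "(p, q)"] by simp

lemma cfun_L2_anti:
  assumes "antisymm f = f" shows "cfun f \<in> L2_anti"
proof -
  have "cfun f \<in> borel_measurable torus2_measure"
    by (intro borel_measurable_torus2 continuous_intros)
  then have "cfun f \<in> L2 torus2_measure"
    by (rule torus2.L2_bounded[where C = "norm f"]) (simp add: abs_bcontfun_le)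
  moreover have "AE (p, q) in torus2_measure. cfun f (p, q) = - cfun f (q, p)"
  proof (rule AE_I2)
    fix x :: "real3 \<times> real3" obtain p q where x: "x = (p, q)" by force
    show "case x of (p, q) \<Rightarrow> cfun f (p, q) = - cfun f (q, p)"
      unfolding x prod.case antisymD[OF assms, of p q] by simp
  qed
  ultimately show ?thesis by (simp add: L2_anti_def)
qed

lemma reduce_antisymD:
  assumes "antisymm f = f"
  shows "torus_mean (\<lambda>s. f (p, s)) = reduce f p" "torus_mean (\<lambda>s. f (s, p)) = - reduce f p"
proof -
  have "(\<lambda>s. f (s, p)) = (\<lambda>s. - 1 * f (p, s))" using antisymD[OF assms, of _ p] by auto
  then have "torus_mean (\<lambda>s. f (s, p)) = - torus_mean (\<lambda>s. f (p, s))" by (simp only: torus_mean_cmult)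
  then show "torus_mean (\<lambda>s. f (p, s)) = reduce f p" "torus_mean (\<lambda>s. f (s, p)) = - reduce f p"
    by (simp_all add: reduce_apply)
qed

text \<open>For antisymmetric \<open>f\<close> the two partial means are \<open>- reduce f q\<close>
  and \<open>reduce f p\<close>, and together they form \<open>lift (reduce f)\<close>.\<close>

lemma H_op_cfun:
  assumes \<gamma>: "\<gamma> \<ge> 0" and f: "antisymm f = f"
  shows "H_op \<gamma> lam K (cfun f)
    = cfun (mult_op (\<lambda>x. dispersion \<gamma> K (fst x) (snd x)) f - lam *\<^sub>R lift (reduce f))"
proof
  fix x :: "real3 \<times> real3" obtain p q where x: "x = (p, q)" by force
  let ?d = "\<lambda>x. dispersion \<gamma> K (fst x) (snd x)"
  have d: "continuous_on UNIV ?d" "\<bar>?d x\<bar> \<le> 12 + 6 * \<gamma>" for x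
    using dispersion_bounds[of \<gamma> K] \<gamma> by (auto simp: dispersion_def intro!: continuous_intros)
  have int: "complex_of_real (lam / (2 * pi) ^ 3) * (\<integral>s. complex_of_real (g s) \<partial>torus_measure)
      = complex_of_real (lam * torus_mean g)" for g
    by (simp add: torus_mean_def)
  show "H_op \<gamma> lam K (cfun f) x = cfun (mult_op ?d f - lam *\<^sub>R lift (reduce f)) x"
    unfolding x H_op_def prod.case int reduce_antisymD[OF f]
    by (simp add: mult_apply[OF d] lift_apply algebra_simps)
qed

definition inner2 :: "two_body \<Rightarrow> two_body \<Rightarrow> real" where
  "inner2 f g = (\<integral>x. f x * g x \<partial>torus2_measure)"

lemma inner2_integrable:
  fixes f g :: two_body
  shows "integrable torus2_measure (\<lambda>x. apply_bcontfun f x * apply_bcontfun g x)"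
proof (rule torus2_integrable)
  show "\<bar>apply_bcontfun f x * apply_bcontfun g x\<bar> \<le> norm f * norm g" for x
    unfolding abs_mult by (intro mult_mono abs_bcontfun_le) auto
qed (intro continuous_intros)

lemma inner2_commute: "inner2 f g = inner2 g f" by (simp add: inner2_def mult.commute)

lemma inner2_add_left: "inner2 (f + f') g = inner2 f g + inner2 f' g"
  by (simp add: inner2_def distrib_right inner2_integrable)

lemma inner2_scaleR_left: "inner2 (r *\<^sub>R f) g = r * inner2 f g"
  by (simp add: inner2_def mult.assoc)

lemma inner2_add_right: "inner2 f (g + g') = inner2 f g + inner2 f g'"
  by (simp only: inner2_commute[of f] inner2_add_left)

lemma inner2_scaleR_right: "inner2 f (r *\<^sub>R g) = r * inner2 f g"
  by (simp only: inner2_commute[of f] inner2_scaleR_left)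

lemma inner2_diff_left: "inner2 (f - f') g = inner2 f g - inner2 f' g"
  by (simp add: inner2_def left_diff_distrib inner2_integrable)

text \<open>Up to a constant, \<open>lift\<close> is the adjoint of \<open>reduce\<close> on
  antisymmetric functions. This gives the symmetry of the interaction term.\<close>

lemma inner2_lift:
  assumes f: "antisymm f = f"
  shows "inner2 (lift \<phi>) f = 2 * ((2 * pi) ^ 3)\<^sup>2 * torus_mean (\<lambda>p. \<phi> p * reduce f p)"
proof -
  let ?V = "((2 * pi) ^ 3)\<^sup>2 :: real"
  have bnd: "\<bar>\<phi> y * f x\<bar> \<le> norm \<phi> * norm f" for x y
    unfolding abs_mult by (intro mult_mono abs_bcontfun_le) auto
  have c1: "continuous_on UNIV (\<lambda>x. \<phi> (fst x) * f x)" and c2: "continuous_on UNIV (\<lambda>x. \<phi> (snd x) * f x)"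
    by (intro continuous_intros)+
  have i: "integrable torus2_measure (\<lambda>x. \<phi> (fst x) * f x)" "integrable torus2_measure (\<lambda>x. \<phi> (snd x) * f x)"
    by (rule torus2_integrable[OF c1 bnd] torus2_integrable[OF c2 bnd])+
  have "inner2 (lift \<phi>) f = (\<integral>x. \<phi> (fst x) * f x \<partial>torus2_measure) - (\<integral>x. \<phi> (snd x) * f x \<partial>torus2_measure)"
    using i by (simp add: inner2_def lift_apply left_diff_distrib)
  also have "(\<integral>x. \<phi> (fst x) * f x \<partial>torus2_measure) = ?V * torus_mean (\<lambda>p. \<phi> p * reduce f p)"
    by (subst torus2_integral[OF c1 bnd]) (simp add: reduce_antisymD[OF f])
  also have "(\<integral>x. \<phi> (snd x) * f x \<partial>torus2_measure) = ?V * torus_mean (\<lambda>p. - (\<phi> p * reduce f p))"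
    by (subst torus2_integral[OF c2 bnd], subst torus_mean_swap[OF c2 bnd]) (simp add: reduce_antisymD[OF f])
  also have "torus_mean (\<lambda>p. - (\<phi> p * reduce f p)) = - torus_mean (\<lambda>p. \<phi> p * reduce f p)"
    using torus_mean_cmult[of "-1" "\<lambda>p. \<phi> p * reduce f p"] by (simp del: torus_mean_cmult)
  finally show ?thesis by simp
qed

lemma inner2_mult_op:
  assumes "continuous_on UNIV g" "\<And>x. \<bar>g x\<bar> \<le> C"
  shows "inner2 (mult_op g f) h = inner2 (mult_op g h) f"
  by (simp add: inner2_def mult_apply[OF assms] mult.commute mult.left_commute)

text \<open>The coefficients are L^2 products with \<open>lift (trig \<alpha> d)\<close>, so null
  sets cannot affect them. Hence vectors of the graph stay nonzero modulo a.e. equality.\<close>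

lemma coeff_reduce_eq_0:
  assumes f: "antisymm f = f" and "AE x in torus2_measure. f x = 0"
  shows "coeff \<alpha> (reduce f) = 0"
proof -
  define c where "c = coeff \<alpha> (reduce f)"
  have "inner2 (lift (trig \<alpha> d)) f = 0" for d
    unfolding inner2_def by (rule integral_eq_zero_AE) (use assms(2) in eventually_elim, simp)
  then have 0: "torus_mean (\<lambda>p. trig \<alpha> d p * reduce f p) = 0" for d
    unfolding inner2_lift[OF f] by simp
  have "c $ i = 0" for i
  proof -
    have "trig \<alpha> (axis i 1) p = cos (p $ i - \<alpha> $ i)" for p
    proof -
      have "trig \<alpha> (axis i 1) p = (\<Sum>j\<in>UNIV. if j = i then cos (p $ j - \<alpha> $ j) else 0)"
        unfolding trig_apply by (intro sum.cong) (auto simp: axis_def)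
      then show ?thesis by simp
    qed
    then show ?thesis using 0[of "axis i 1"] by (simp add: c_def coeff_apply)
  qed
  then show ?thesis by (simp add: c_def vec_eq_iff)
qed

lemma three_eigenvalues:
  fixes K \<alpha> :: real3 and \<gamma> lam \<sigma> :: real
  assumes \<gamma>: "\<gamma> \<ge> 2 * 10 ^ 6" and lam: "lam \<ge> 100 * \<gamma> ^ 3" and \<sigma>: "\<bar>\<sigma>\<bar> = 1"
    and K: "\<And>i x. cos (K $ i - x) = - \<sigma> * cos (x - 2 * \<alpha> $ i)"
    and I: "\<And>z. \<bar>z - (3 * \<gamma> - lam - \<sigma> * \<gamma> / 2)\<bar> \<le> 3780 \<Longrightarrow> z \<in> I"
  shows "3 \<le> eigenvalue_count torus2_measure L2_anti (H_op \<gamma> lam K) I"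
proof -
  let ?d = "\<lambda>x. dispersion \<gamma> K (fst x) (snd x)"
  define m where "m = 3 * \<gamma> - lam - \<sigma> * \<gamma> / 2"
  have \<gamma>0: "\<gamma> \<ge> 0" using \<gamma> by simp
  have d: "continuous_on UNIV ?d" "\<bar>?d x\<bar> \<le> 12 + 6 * \<gamma>" for x
    using dispersion_bounds[of \<gamma> K] \<gamma>0 by (auto simp: dispersion_def intro!: continuous_intros)
  obtain F :: "real3 \<Rightarrow>\<^sub>L two_body" and N :: "real3 \<Rightarrow>\<^sub>L real3"
    where F: "\<And>c. coeff \<alpha> (reduce (F c)) = c" "\<And>c. antisymm (F c) = F c"
      "\<And>c. mult_op ?d (F c) - lam *\<^sub>R lift (reduce (F c)) = F (N c)"
      "\<And>c. norm (N c - m *\<^sub>R c) \<le> 3780 * norm c"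
    using invariant_subspace[OF \<gamma> lam \<sigma> K] unfolding m_def by blast
  have F0: "c = 0" if "AE x in torus2_measure. F c x = 0" for c
    using coeff_reduce_eq_0[OF F(2) that, of \<alpha>] by (simp add: F(1))
  \<comment> \<open>\<open>N\<close> is symmetric for this pulled-back product, since H is symmetric
    on the image of \<open>F\<close>, and not in general for the Euclidean one. Positivity holds
    because \<open>coeff \<alpha>\<close> composed with \<open>reduce\<close> is a left inverse of
    \<open>F\<close>.\<close>
  define g where "g c d = inner2 (F c) (F d)" for c d
  have g: "bilinear g"
    unfolding bilinear_def
    by (auto intro!: linearI simp: g_def blinfun.add_right blinfun.scaleR_right inner2_add_left
        inner2_scaleR_left inner2_add_right inner2_scaleR_right)
  have sym: "g c d = g d c" for c d unfolding g_def by (rule inner2_commute)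
  have pos: "g c c > 0" if "c \<noteq> 0" for c
  proof -
    have "g c c \<noteq> 0"
    proof
      assume "g c c = 0"
      then have "AE x in torus2_measure. F c x * F c x = 0"
        unfolding g_def inner2_def
        by (subst (asm) integral_nonneg_eq_0_iff_AE[OF inner2_integrable]) auto
      then have "AE x in torus2_measure. F c x = 0" by simp
      then show False using F0 that by blast
    qed
    moreover have "g c c \<ge> 0" unfolding g_def inner2_def by simp
    ultimately show ?thesis by simp
  qed
  have adj: "g (N c) d = g c (N d)" for c d
  proof -
    have lift: "inner2 (lift (reduce (F c))) (F d) = inner2 (lift (reduce (F d))) (F c)" for c d
      unfolding inner2_lift[OF F(2)] by (simp add: mult.commute)
    have "g (N c) d = inner2 (mult_op ?d (F c)) (F d) - lam * inner2 (lift (reduce (F c))) (F d)"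
      unfolding g_def F(3)[symmetric] inner2_diff_left inner2_scaleR_left ..
    also have "\<dots> = inner2 (mult_op ?d (F d)) (F c) - lam * inner2 (lift (reduce (F d))) (F c)"
      unfolding lift[of c d] inner2_mult_op[OF d, of "F c"] ..
    also have "\<dots> = g (N d) c"
      unfolding g_def F(3)[symmetric] inner2_diff_left inner2_scaleR_left ..
    finally show ?thesis using sym by simp
  qed
  have "linear N" by (simp add: blinfun.bounded_linear_right bounded_linear.linear)
  from selfadjoint_eigenbasis[OF this g sym pos adj] obtain B
    where B: "independent B" "card B = 3" "\<And>x. x \<in> B \<Longrightarrow> \<exists>z. N x = z *\<^sub>R x"
    by auto
  obtain z where z: "\<And>x. x \<in> B \<Longrightarrow> N x = z x *\<^sub>R x" using B(3) by metis
  have finB: "finite B" using B(1) independent_imp_finite by blast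
  obtain h where h: "bij_betw h {..<3::nat} B"
    using ex_bij_betw_nat_finite[OF finB] unfolding B(2) lessThan_atLeast0 by blast
  have hB: "h i \<in> B" if "i < 3" for i using h that unfolding bij_betw_def by auto
  have "enat 3 \<le> eigenvalue_count torus2_measure L2_anti (H_op \<gamma> lam K) I"
  proof (rule eigenvalue_count_ge)
    fix i :: nat assume i: "i < 3"
    have eig: "N (h i) = z (h i) *\<^sub>R h i" by (rule z[OF hB[OF i]])
    have "H_op \<gamma> lam K (cfun (F (h i))) = cfun (F (N (h i)))"
      unfolding H_op_cfun[OF \<gamma>0 F(2)] F(3) ..
    then show "cfun (F (h i)) \<in> eigenspace torus2_measure L2_anti (H_op \<gamma> lam K) (complex_of_real (z (h i)))"
      using cfun_L2_anti[OF F(2)] by (simp add: eigenspace_def eig blinfun.scaleR_right)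
    have "h i \<noteq> 0" using B(1) hB[OF i] dependent_zero by metis
    moreover have "norm ((z (h i) - m) *\<^sub>R h i) \<le> 3780 * norm (h i)"
      using F(4)[of "h i"] by (simp add: eig scaleR_diff_left)
    ultimately show "z (h i) \<in> I" unfolding m_def by (intro I) simp
  next
    show "independent_AE torus2_measure 3 (\<lambda>i. cfun (F (h i)))"
      unfolding independent_AE_def
    proof (intro allI impI)
      fix c :: "nat \<Rightarrow> complex" and i :: nat
      assume c: "AE x in torus2_measure. (\<Sum>i<3. c i * cfun (F (h i)) x) = 0" and i: "i < 3"
      \<comment> \<open>\<open>B\<close> is independent over the reals only. Complex coefficients
        are handled by their real and imaginary parts, as all \<open>F (h i)\<close> are
        real.\<close>
      have zero: "r i = 0" if r: "AE x in torus2_measure. (\<Sum>i<3. r i * F (h i) x) = 0" for r :: "nat \<Rightarrow> real"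
      proof -
        have ap: "apply_bcontfun (\<Sum>i\<in>A. f i) x = (\<Sum>i\<in>A. apply_bcontfun (f i) x)"
          for A :: "nat set" and f :: "nat \<Rightarrow> two_body" and x
          by (induction A rule: infinite_finite_induct) auto
        have "apply_bcontfun (F (\<Sum>i<3. r i *\<^sub>R h i)) x = (\<Sum>i<3. r i * F (h i) x)" for x
          by (simp add: blinfun.sum_right blinfun.scaleR_right ap)
        then have "(\<Sum>i<3. r i *\<^sub>R h i) = 0" using r by (intro F0) simp
        moreover have "(\<Sum>i<3. r i *\<^sub>R h i) = (\<Sum>x\<in>B. r (the_inv_into {..<3} h x) *\<^sub>R x)"
          using sum.reindex_bij_betw[OF h, of "\<lambda>x. r (the_inv_into {..<3} h x) *\<^sub>R x"] h
          by (simp add: bij_betw_def the_inv_into_f_f)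
        ultimately have "r (the_inv_into {..<3} h (h i)) = 0"
          using independentD[OF B(1) finB subset_refl _ hB[OF i], of "\<lambda>x. r (the_inv_into {..<3} h x)"]
          by simp
        then show ?thesis using h i by (simp add: bij_betw_def the_inv_into_f_f)
      qed
      have "AE x in torus2_measure. (\<Sum>i<3. Re (c i) * F (h i) x) = 0"
        using c by eventually_elim (simp add: complex_eq_iff)
      moreover have "AE x in torus2_measure. (\<Sum>i<3. Im (c i) * F (h i) x) = 0"
        using c by eventually_elim (simp add: complex_eq_iff)
      ultimately show "c i = 0" using zero[of "\<lambda>i. Re (c i)"] zero[of "\<lambda>i. Im (c i)"]
        by (simp add: complex_eq_iff)
    qed
  qed
  then show ?thesis by (simp add: numeral_eq_enat)
qed

theorem corollary1p4:
  fixes K :: "real^3"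
  assumes "K \<in> torus"
  shows "\<exists>\<gamma>\<^sub>1 > 0. \<exists>\<gamma>\<^sub>2 > 0. \<forall>\<gamma> > max \<gamma>\<^sub>1 \<gamma>\<^sub>2.
    \<exists>lam\<^sub>0 > 0. \<forall>lam > lam\<^sub>0.
      eigenvalue_count torus2_measure L2_anti (H_op \<gamma> lam K)
        {..< tau_min \<gamma> K lam} \<ge> 3 \<and>
      eigenvalue_count torus2_measure L2_anti (H_op \<gamma> lam K)
        {tau_max \<gamma> K lam <..< dispersion_min \<gamma> K} \<ge> 3"
proof -
  \<comment> \<open>All the bounds are uniform in \<open>K\<close>, so both thresholds can be the
    number \<open>2 * 10 ^ 6\<close> required by the contraction, and
    \<open>100 * \<gamma> ^ 3\<close> serves as threshold for \<open>lam\<close>.\<close>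
  have main: "3 \<le> eigenvalue_count torus2_measure L2_anti (H_op \<gamma> lam K) {..< tau_min \<gamma> K lam} \<and>
      3 \<le> eigenvalue_count torus2_measure L2_anti (H_op \<gamma> lam K)
        {tau_max \<gamma> K lam <..< dispersion_min \<gamma> K}"
    if \<gamma>: "\<gamma> > 2 * 10 ^ 6" and lam: "lam > 100 * \<gamma> ^ 3" for \<gamma> lam :: real
  proof -
    have \<gamma>1: "\<gamma> \<le> \<gamma>\<^sup>2" "\<gamma>\<^sup>2 \<le> \<gamma> ^ 3" using \<gamma> power_increasing[of 1 2 \<gamma>] power_increasing[of 2 3 \<gamma>] by auto
    have \<gamma>2: "\<gamma> > 2000000" using \<gamma> by simp
    have l1: "lam > 9 + 3 * \<gamma>" and l2: "36 * \<gamma> + 9 * \<gamma>\<^sup>2 < lam" and l3: "4 * \<gamma> < lam"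
      using \<gamma>1 \<gamma>2 lam by linarith+
    have "3 * \<gamma> * (12 + 3 * \<gamma>) = 36 * \<gamma> + 9 * \<gamma>\<^sup>2" by (simp add: power2_eq_square algebra_simps)
    with l2 have l2: "lam > 3 * \<gamma> * (12 + 3 * \<gamma>)" by simp
    have \<gamma>0: "\<gamma> \<ge> 0" using \<gamma> by simp
    note tau = tau_bounds[OF \<gamma>0 l1 l2, of K] and d0 = dispersion_min_nonneg[OF \<gamma>0, of K]
    show ?thesis
    proof
      \<comment> \<open>The extra shift by \<pi> / 2 turns the cosines of
        \<open>trig \<alpha>\<close> into the sines s_i, which carry the lower triple.\<close>
      show "3 \<le> eigenvalue_count torus2_measure L2_anti (H_op \<gamma> lam K) {..< tau_min \<gamma> K lam}"
      proof (rule three_eigenvalues[where \<sigma> = 1 and \<alpha> = "\<chi> i. K $ i / 2 + pi / 2"])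
        show "cos (K $ i - x) = - 1 * cos (x - 2 * (\<chi> i. K $ i / 2 + pi / 2) $ i)" for i x
        proof -
          have "cos (x - 2 * (\<chi> i. K $ i / 2 + pi / 2) $ i) = cos ((x - K $ i) - pi)"
            by (simp add: algebra_simps)
          also have "\<dots> = - cos (x - K $ i)" by simp
          also have "cos (x - K $ i) = cos (K $ i - x)" using cos_minus[of "x - K $ i"] by simp
          finally show ?thesis by simp
        qed
        show "z \<in> {..< tau_min \<gamma> K lam}" if "\<bar>z - (3 * \<gamma> - lam - 1 * \<gamma> / 2)\<bar> \<le> 3780" for z
        proof -
          have "z < 3 * \<gamma> - lam" using that \<gamma>2 unfolding abs_le_iff by linarith
          then show ?thesis using tau(1) by simp
        qed
      qed (use \<gamma> lam in auto)
      show "3 \<le> eigenvalue_count torus2_measure L2_anti (H_op \<gamma> lam K)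
          {tau_max \<gamma> K lam <..< dispersion_min \<gamma> K}"
      proof (rule three_eigenvalues[where \<sigma> = "-1" and \<alpha> = "\<chi> i. K $ i / 2"])
        show "cos (K $ i - x) = - (- 1) * cos (x - 2 * (\<chi> i. K $ i / 2) $ i)" for i x
          using cos_minus[of "x - K $ i"] by simp
        show "z \<in> {tau_max \<gamma> K lam <..< dispersion_min \<gamma> K}"
          if "\<bar>z - (3 * \<gamma> - lam - (- 1) * \<gamma> / 2)\<bar> \<le> 3780" for z
        proof -
          \<comment> \<open>The first bound holds since \<gamma> / 2 exceeds 3780 + 9, the second
            since \<open>4 * \<gamma> < lam\<close> puts the upper triple below 0 and so below the
            nonnegative three-particle branch.\<close>
          have "9 + 3 * \<gamma> - lam < z" "z < 0" using that \<gamma>2 l3 unfolding abs_le_iff by linarith+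
          then show ?thesis using tau(2) d0 by simp
        qed
      qed (use \<gamma> lam in auto)
    qed
  qed
  have "\<exists>lam\<^sub>0 > 0. \<forall>lam > lam\<^sub>0.
      3 \<le> eigenvalue_count torus2_measure L2_anti (H_op \<gamma> lam K) {..< tau_min \<gamma> K lam} \<and>
      3 \<le> eigenvalue_count torus2_measure L2_anti (H_op \<gamma> lam K)
        {tau_max \<gamma> K lam <..< dispersion_min \<gamma> K}" if "\<gamma> > 2 * 10 ^ 6" for \<gamma> :: real
    using main[OF that] that by (intro exI[of _ "100 * \<gamma> ^ 3"]) auto
  note * = this
  show ?thesis
    by (rule exI[of _ "2 * 10 ^ 6"], rule conjI, simp, rule exI[of _ "2 * 10 ^ 6"], rule conjI, simp,
      intro allI impI *) simp
qed

end
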